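(* For each fixed $M$, the maps $\lambda:\mathbb{B}\times\mathbb{L}_{Q,M}\to\mathbb{R}$ and $\tilde\lambda:\mathbb{B}\times\mathbb{L}_{Q,M}\to L_\infty(0,1)^2$, $$\lambda(Q,K)=\int_0^1Q\,dK,\qquad\tilde\lambda(Q,K)(s,t)=\int_s^tQ\,dK,$$ are Hadamard differentiable at every $(Q,K)\in\mathbb{B}\times\mathbb{L}_{Q,M}$ uniformly over $K\in\mathbb{L}_{Q,M}$. The derivative maps are $$\lambda'_{Q,K}(z,\kappa)=\int_0^1Q\,d\kappa+\int_0^1z\,dK,\qquad\tilde\lambda'_{Q,K}(z,\kappa)(s,t)=\int_s^tQ\,d\kappa+\int_s^tz\,dK,$$ where $\int Q\,d\kappa$ is defined via integration by parts if $\kappa$ is of unbounded variation.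
   Context: $\mathbb{B}$ is the space of ladcag (left-continuous with right limits) functions $z:(0,1)\to\mathbb{R}$ with norm $\|z\|_{\mathbb{B}}=\int_0^1|z(u)|\,du$. For an integrable increasing function $Q:(0,1)\to\mathbb{R}$, $\mathbb{L}_Q$ is the space of functions $\kappa:(0,1)\to\mathbb{R}$ with norm $\|\kappa\|_{\mathbb{L}_Q}=\bigl(\sup_{u\in(0,1)}|(|Q|\vee1)(u)\kappa(u)|\bigr)\vee\bigl(\int_0^1|\kappa|\,dQ\bigr)$, and $\mathbb{L}_{Q,M}\subset\mathbb{L}_Q$ is the subset of Lipschitz functions with Lipschitz constants bounded by $M$. The function $Q$ defining the space $\mathbb{L}_{Q,M}$ is the same (increasing, integrable) $Q\in\mathbb{B}$ as the first coordinate of the point of differentiation. $L_\infty(0,1)^2$ is the space of bounded functions of $(s,t)\in(0,1)^2$ with the supremum norm. Hadamard differentiability at $(Q,K)$ means: there is a continuous linear map $\lambda'_{Q,K}$ on $\mathbb{B}\times\mathbb{L}_Q$ such that for all $z_t\to z$ in $\mathbb{B}$ and $\kappa_t\to\kappa$ in $\mathbb{L}_Q$ with $Q+tz_t\in\mathbb{B}$ and $K+t\kappa_t\in\mathbb{L}_{Q,M}$, $(\lambda(Q+tz_t,K+t\kappa_t)-\lambda(Q,K))/t\to\lambda'_{Q,K}(z,\kappa)$ as $t\to0$; "uniformly over $\mathbb{L}_{Q,M}$" means that the convergence $\bigl\|(\lambda(Q+tz_t,K+t\kappa_t)-\lambda(Q,K))/t-\lambda'_{Q,K}(z_t,\kappa_t)\bigr\|\to0$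 does not depend on the choice of $K\in\mathbb{L}_{Q,M}$. Likewise for $\tilde\lambda$.
   Formalization: λ' is a continuous linear map on all of B×L_Q; its formula is asserted where ∫Q dκ exists or Qκ has limits at 0 and 1 (proved for all limit directions; fails for Q=1, κ=sin(1/u)); ∫Q dκ is also by parts for bounded-variation κ that is not right-continuous. *)

theory Defs
  imports "HOL-Analysis.Analysis"
begin

text \<open>
  Functions on the unit interval are represented by functions \<open>real \<Rightarrow> real\<close> of which only the
  values on \<open>{0<..<1}\<close> matter.
\<close>

section \<open>Lebesgue--Stieltjes integration on the open unit interval\<close>

text \<open>
  The Lebesgue--Stieltjes measures on \<open>{0<..<1}\<close> of an increasing function that is left-continuous
  (mass of \<open>{a..<b}\<close> is \<open>F b - F a\<close>), respectively right-continuous (mass of \<open>{a<..b}\<close>).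
  They are built exactly as \<^const>\<open>interval_measure\<close>, which is not applicable itself because \<open>F\<close>
  may be unbounded near the endpoints of \<open>{0<..<1}\<close>.
\<close>

definition stieltjes_measure_lc :: "(real \<Rightarrow> real) \<Rightarrow> real measure" where
  "stieltjes_measure_lc F =
     extend_measure {0<..<1} {(a, b). 0 < a \<and> a \<le> b \<and> b < 1}
       (\<lambda>(a, b). {a..<b}) (\<lambda>(a, b). ennreal (F b - F a))"

definition stieltjes_measure_rc :: "(real \<Rightarrow> real) \<Rightarrow> real measure" where
  "stieltjes_measure_rc F =
     extend_measure {0<..<1} {(a, b). 0 < a \<and> a \<le> b \<and> b < 1}
       (\<lambda>(a, b). {a<..b}) (\<lambda>(a, b). ennreal (F b - F a))"

definition incr_rc :: "(real \<Rightarrow> real) \<Rightarrow> bool" where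
  "incr_rc F \<longleftrightarrow> mono_on {0<..<1} F \<and> (\<forall>u\<in>{0<..<1}. continuous (at_right u) F)"

text \<open>
  The Lebesgue--Stieltjes integral of \<open>f\<close> over \<open>A\<close> against a right-continuous function \<open>\<kappa>\<close> that is
  (locally) of bounded variation, i.e. a difference of two increasing functions. The value does not
  depend on the decomposition. Integrands below are left-continuous; every Lipschitz \<open>\<kappa>\<close> is covered.
\<close>

definition has_LS_integral ::
    "(real \<Rightarrow> real) \<Rightarrow> (real \<Rightarrow> real) \<Rightarrow> real set \<Rightarrow> real \<Rightarrow> bool" where
  "has_LS_integral f \<kappa> A I \<longleftrightarrow>
     (\<exists>G H. incr_rc G \<and> incr_rc H \<and> (\<forall>u\<in>{0<..<1}. \<kappa> u = G u - H u) \<and>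
        set_integrable (stieltjes_measure_rc G) A f \<and>
        set_integrable (stieltjes_measure_rc H) A f \<and>
        I = (LINT u:A|stieltjes_measure_rc G. f u) - (LINT u:A|stieltjes_measure_rc H. f u))"

definition LS_integrable :: "(real \<Rightarrow> real) \<Rightarrow> (real \<Rightarrow> real) \<Rightarrow> real set \<Rightarrow> bool" where
  "LS_integrable f \<kappa> A \<longleftrightarrow> (\<exists>I. has_LS_integral f \<kappa> A I)"

definition LS_integral :: "(real \<Rightarrow> real) \<Rightarrow> (real \<Rightarrow> real) \<Rightarrow> real set \<Rightarrow> real" where
  "LS_integral f \<kappa> A = (THE I. has_LS_integral f \<kappa> A I)"

section \<open>The function spaces\<close>

definition ladcag_space :: "(real \<Rightarrow> real) set" where
  "ladcag_space =
     {z. (\<forall>u\<in>{0<..<1}. continuous (at_left u) z \<and> (\<exists>l. (z \<longlongrightarrow> l) (at_right u))) \<and>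
         set_integrable lborel {0<..<1} z}"

definition ladcag_norm :: "(real \<Rightarrow> real) \<Rightarrow> real" where
  "ladcag_norm z = (LINT u:{0<..<1}|lborel. \<bar>z u\<bar>)"

definition LQ_space :: "(real \<Rightarrow> real) \<Rightarrow> (real \<Rightarrow> real) set" where
  "LQ_space Q =
     {\<kappa>. bdd_above ((\<lambda>u. \<bar>max \<bar>Q u\<bar> 1 * \<kappa> u\<bar>) ` {0<..<1}) \<and>
         integrable (stieltjes_measure_lc Q) \<kappa>}"

definition LQ_norm :: "(real \<Rightarrow> real) \<Rightarrow> (real \<Rightarrow> real) \<Rightarrow> real" where
  "LQ_norm Q \<kappa> =
     max (SUP u\<in>{0<..<1}. \<bar>max \<bar>Q u\<bar> 1 * \<kappa> u\<bar>) (LINT u|stieltjes_measure_lc Q. \<bar>\<kappa> u\<bar>)"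

definition LQM_space :: "(real \<Rightarrow> real) \<Rightarrow> real \<Rightarrow> (real \<Rightarrow> real) set" where
  "LQM_space Q M = {K \<in> LQ_space Q. M-lipschitz_on {0<..<1} K}"

text \<open>Bounded functions on an index set; the scalar case is \<open>I = (UNIV :: unit set)\<close>.\<close>

definition Linf_space :: "'i set \<Rightarrow> ('i \<Rightarrow> real) set" where
  "Linf_space I = {f. bdd_above ((\<lambda>i. \<bar>f i\<bar>) ` I)}"

definition Linf_norm :: "'i set \<Rightarrow> ('i \<Rightarrow> real) \<Rightarrow> real" where
  "Linf_norm I f = (SUP i\<in>I. \<bar>f i\<bar>)"

section \<open>Uniform Hadamard differentiability\<close>

definition bounded_linear_LQ ::
    "'i set \<Rightarrow> (real \<Rightarrow> real) \<Rightarrow> ((real \<Rightarrow> real) \<Rightarrow> (real \<Rightarrow> real) \<Rightarrow> 'i \<Rightarrow> real) \<Rightarrow> bool" where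
  "bounded_linear_LQ I Q D \<longleftrightarrow>
     (\<forall>z\<in>ladcag_space. \<forall>\<kappa>\<in>LQ_space Q. D z \<kappa> \<in> Linf_space I) \<and>
     (\<forall>z\<in>ladcag_space. \<forall>w\<in>ladcag_space. \<forall>\<kappa>\<in>LQ_space Q. \<forall>\<eta>\<in>LQ_space Q. \<forall>a b. \<forall>i\<in>I.
        D (\<lambda>u. a * z u + b * w u) (\<lambda>u. a * \<kappa> u + b * \<eta> u) i = a * D z \<kappa> i + b * D w \<eta> i) \<and>
     (\<exists>C. \<forall>z\<in>ladcag_space. \<forall>\<kappa>\<in>LQ_space Q.
        Linf_norm I (D z \<kappa>) \<le> C * (ladcag_norm z + LQ_norm Q \<kappa>))"

text \<open>
  \<open>z\<^sub>t \<rightarrow> z\<close> and \<open>\<kappa>\<^sub>t \<rightarrow> \<kappa>\<close> as \<open>t \<rightarrow> 0\<close>, with \<open>Q + t z\<^sub>t\<close> in the ladcag space. An arbitrary proper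
  filter finer than \<^term>\<open>at 0\<close> is allowed, so that two-sided, one-sided and sequential limits
  \<open>t \<rightarrow> 0\<close> are all included.
\<close>

definition hadamard_path ::
    "(real \<Rightarrow> real) \<Rightarrow> real filter \<Rightarrow> (real \<Rightarrow> real \<Rightarrow> real) \<Rightarrow> (real \<Rightarrow> real \<Rightarrow> real) \<Rightarrow>
     (real \<Rightarrow> real) \<Rightarrow> (real \<Rightarrow> real) \<Rightarrow> bool" where
  "hadamard_path Q F zt \<kappa>t z \<kappa> \<longleftrightarrow>
     F \<noteq> bot \<and> F \<le> at 0 \<and> z \<in> ladcag_space \<and> \<kappa> \<in> LQ_space Q \<and>
     (\<forall>\<^sub>F t in F. zt t \<in> ladcag_space \<and> \<kappa>t t \<in> LQ_space Q \<and>
        (\<lambda>u. Q u + t * zt t u) \<in> ladcag_space) \<and>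
     ((\<lambda>t. ladcag_norm (\<lambda>u. zt t u - z u)) \<longlongrightarrow> 0) F \<and>
     ((\<lambda>t. LQ_norm Q (\<lambda>u. \<kappa>t t u - \<kappa> u)) \<longlongrightarrow> 0) F"

definition hadamard_admissible ::
    "(real \<Rightarrow> real) \<Rightarrow> real \<Rightarrow> real filter \<Rightarrow> (real \<Rightarrow> real \<Rightarrow> real) \<Rightarrow> (real \<Rightarrow> real) \<Rightarrow> bool" where
  "hadamard_admissible Q M F \<kappa>t K \<longleftrightarrow> (\<forall>\<^sub>F t in F. (\<lambda>u. K u + t * \<kappa>t t u) \<in> LQM_space Q M)"

text \<open>
  \<open>\<phi>\<close> takes values in the bounded functions on \<open>I\<close> and is Hadamard differentiable at \<open>(Q, K)\<close> with
  derivative \<open>D K\<close>, for every \<open>K\<close> in \<^term>\<open>LQM_space Q M\<close>; in the last clause the remainder (with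
  the derivative taken at the moving directions \<open>z\<^sub>t\<close>, \<open>\<kappa>\<^sub>t\<close>) vanishes uniformly in \<open>K\<close>.
\<close>

definition unif_hadamard_derivative ::
    "'i set \<Rightarrow> (real \<Rightarrow> real) \<Rightarrow> real \<Rightarrow>
     ((real \<Rightarrow> real) \<Rightarrow> (real \<Rightarrow> real) \<Rightarrow> 'i \<Rightarrow> real) \<Rightarrow>
     ((real \<Rightarrow> real) \<Rightarrow> (real \<Rightarrow> real) \<Rightarrow> (real \<Rightarrow> real) \<Rightarrow> 'i \<Rightarrow> real) \<Rightarrow> bool" where
  "unif_hadamard_derivative I Q M \<phi> D \<longleftrightarrow>
     (\<forall>q\<in>ladcag_space. \<forall>K\<in>LQM_space Q M. \<phi> q K \<in> Linf_space I) \<and>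
     (\<forall>K\<in>LQM_space Q M. bounded_linear_LQ I Q (D K)) \<and>
     (\<forall>F zt \<kappa>t z \<kappa>. hadamard_path Q F zt \<kappa>t z \<kappa> \<longrightarrow>
        (\<forall>K\<in>LQM_space Q M. hadamard_admissible Q M F \<kappa>t K \<longrightarrow>
           ((\<lambda>t. Linf_norm I (\<lambda>i.
               (\<phi> (\<lambda>u. Q u + t * zt t u) (\<lambda>u. K u + t * \<kappa>t t u) i - \<phi> Q K i) / t - D K z \<kappa> i))
             \<longlongrightarrow> 0) F) \<and>
        (\<forall>\<epsilon>>0. \<forall>\<^sub>F t in F. \<forall>K\<in>LQM_space Q M. (\<lambda>u. K u + t * \<kappa>t t u) \<in> LQM_space Q M \<longrightarrow>
           Linf_norm I (\<lambda>i.
             (\<phi> (\<lambda>u. Q u + t * zt t u) (\<lambda>u. K u + t * \<kappa>t t u) i - \<phi> Q K i) / t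
               - D K (zt t) (\<kappa>t t) i) < \<epsilon>))"

section \<open>The maps and the derivative formulas\<close>

definition lam :: "(real \<Rightarrow> real) \<Rightarrow> (real \<Rightarrow> real) \<Rightarrow> real" where
  "lam q K = LS_integral q K {0<..<1}"

text \<open>For \<open>t < s\<close> the integral from \<open>s\<close> to \<open>t\<close> is minus the integral from \<open>t\<close> to \<open>s\<close>.\<close>

definition lam_tilde :: "(real \<Rightarrow> real) \<Rightarrow> (real \<Rightarrow> real) \<Rightarrow> real \<times> real \<Rightarrow> real" where
  "lam_tilde q K = (\<lambda>(s, t).
     if s \<le> t then LS_integral q K {s<..t} else - LS_integral q K {t<..s})"

text \<open>
  The integral of an increasing \<open>Q\<close> against \<open>\<kappa>\<close>: a Lebesgue--Stieltjes integral if that exists, and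
  defined through integration by parts otherwise. Over the whole of \<open>{0<..<1}\<close> the boundary terms
  are the limits of \<open>Q \<kappa>\<close>, which do not exist for every \<open>\<kappa>\<close> in \<^term>\<open>LQ_space Q\<close>. For the half-open
  intervals, \<open>{s<..t}\<close> for \<open>d\<kappa>\<close> is paired with \<open>{s..<t}\<close> for \<open>dQ\<close>, in accordance with the one-sided
  continuity of \<open>\<kappa>\<close> and \<open>Q\<close>.
\<close>

definition int_dom :: "(real \<Rightarrow> real) \<Rightarrow> (real \<Rightarrow> real) set" where
  "int_dom Q = {\<kappa> \<in> LQ_space Q. LS_integrable Q \<kappa> {0<..<1} \<or>
     (\<exists>l r. ((\<lambda>u. Q u * \<kappa> u) \<longlongrightarrow> l) (at_right 0) \<and> ((\<lambda>u. Q u * \<kappa> u) \<longlongrightarrow> r) (at_left 1))}"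

definition int_dir :: "(real \<Rightarrow> real) \<Rightarrow> (real \<Rightarrow> real) \<Rightarrow> real" where
  "int_dir Q \<kappa> =
     (if LS_integrable Q \<kappa> {0<..<1} then LS_integral Q \<kappa> {0<..<1}
      else Lim (at_left 1) (\<lambda>u. Q u * \<kappa> u) - Lim (at_right 0) (\<lambda>u. Q u * \<kappa> u)
             - (LINT u|stieltjes_measure_lc Q. \<kappa> u))"

definition int_dir_Ioc :: "(real \<Rightarrow> real) \<Rightarrow> (real \<Rightarrow> real) \<Rightarrow> real \<Rightarrow> real \<Rightarrow> real" where
  "int_dir_Ioc Q \<kappa> s t =
     (if LS_integrable Q \<kappa> {s<..t} then LS_integral Q \<kappa> {s<..t}
      else Q t * \<kappa> t - Q s * \<kappa> s - (LINT u:{s..<t}|stieltjes_measure_lc Q. \<kappa> u))"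

definition lam_tilde_deriv ::
    "(real \<Rightarrow> real) \<Rightarrow> (real \<Rightarrow> real) \<Rightarrow> (real \<Rightarrow> real) \<Rightarrow> (real \<Rightarrow> real) \<Rightarrow> real \<times> real \<Rightarrow> real" where
  "lam_tilde_deriv Q K z \<kappa> = (\<lambda>(s, t).
     (if s \<le> t then int_dir_Ioc Q \<kappa> s t else - int_dir_Ioc Q \<kappa> t s) + lam_tilde z K (s, t))"

end

theory Submission
  imports Defs
begin

text \<open>
  For \<open>K + t \<kappa>\<^sub>t\<close> and \<open>K\<close> both \<open>M\<close>-Lipschitz, bilinearity leaves a remainder \<open>\<integral> z\<^sub>t d(t \<kappa>\<^sub>t)\<close>
  in the difference quotient, where the integrator is \<open>2M\<close>-Lipschitz and tends to zero uniformly.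
  Integration against an \<open>L\<close>-Lipschitz function is bounded by \<open>L\<close> times the Lebesgue \<open>L\<^sup>1\<close> norm, so
  \<open>z\<^sub>t\<close> may be replaced by its limit and then by a step function, for which the integral is a
  combination of increments of the integrator. Continuity of the derivative in \<open>\<kappa>\<close> comes from integration
  by parts. Over the whole interval the boundary terms need not converge for every
  \<open>\<kappa>\<close>, and the derivative is extended to all of \<open>LQ_space Q\<close> by a generalized limit.
\<close>

section \<open>Stieltjes measures\<close>

text \<open>The norm of \<open>LQ_space Q\<close> controls the values of an integrator and not its
  variation: for \<open>\<kappa>t t\<close> only the Lipschitz constant
  \<open>2 * M / \<bar>t\<bar>\<close> is available, and a limit direction \<kappa> may have
  unbounded variation. Hence the remainder is not bounded by a product of norms; it vanishes without
  a rate. How small the integrator must be depends on z, M and the tolerance alone, never on K, and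
  this is the source of the uniformity. The same obstacle shapes the derivative. Integration by
  parts puts \<kappa> under an integral against dQ, but leaves boundary values of
  \<open>Q u * \<kappa> u\<close>, which the norm merely keeps bounded. For half-open intervals
  inside the unit interval these are point values; at 0 and 1 they may oscillate. Limits of
  admissible paths turn out to have boundary limits, so the noncanonical part of the extension never
  meets a difference quotient. All estimates for Lipschitz K rest on one decomposition: half of
  \<open>L * u + K u\<close> and half of \<open>L * u - K u\<close> are increasing and add up to
  \<open>L * u\<close>.\<close>

abbreviation unit_borel :: "real measure" where
  "unit_borel \<equiv> restrict_space borel {0<..<1}"

lemma incr_rcD:
  assumes "incr_rc F"
  shows "mono_on {0<..<1} F" "u \<in> {0<..<1} \<Longrightarrow> continuous (at_right u) F"
  using assms by (auto simp: incr_rc_def)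

definition incr_lc :: "(real \<Rightarrow> real) \<Rightarrow> bool" where
  "incr_lc F \<longleftrightarrow> mono_on {0<..<1} F \<and> (\<forall>u\<in>{0<..<1}. continuous (at_left u) F)"

lemma incr_lcD:
  assumes "incr_lc F"
  shows "mono_on {0<..<1} F" "u \<in> {0<..<1} \<Longrightarrow> continuous (at_left u) F"
  using assms by (auto simp: incr_lc_def)

text \<open>Measurability of the identity says that S contains the trace of every Borel set. Since
  measurability can be tested on rays, a generator only has to produce the traces of rays.\<close>

lemma sets_unit_borel_subset:
  assumes "sigma_algebra {0<..<1} S" and "(\<lambda>x. x) \<in> borel_measurable (sigma {0<..<1::real} S)"
  shows "sets unit_borel \<subseteq> S"
proof
  fix A :: "real set" assume "A \<in> sets unit_borel"
  then obtain B where B: "B \<in> sets borel" "A = {0<..<1} \<inter> B"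
    by (auto simp: sets_restrict_space)
  have "(\<lambda>x. x) -` B \<inter> space (sigma {0<..<1::real} S) \<in> sets (sigma {0<..<1} S)"
    using assms(2) B(1) by (rule measurable_sets)
  moreover have "S \<subseteq> Pow {0<..<1}"
    using assms(1) by (meson sigma_algebra_iff2)
  ultimately show "A \<in> S"
    using B(2) sigma_algebra.sigma_sets_eq[OF assms(1)]
    by (simp add: space_measure_of sets_measure_of Int_commute)
qed

text \<open>Rational endpoints make the union countable. The intervals are closed on the side facing
  y, so they stop strictly short of it; the same is done from the other side for
  \<open>{a..<b}\<close> below.\<close>

lemma unit_lessThan_eq_Union:
  "{x\<in>{0<..<1}. x < y} =
     (\<Union>(a, b) \<in> {(a, b). a \<in> \<rat> \<and> b \<in> \<rat> \<and> 0 < a \<and> a \<le> b \<and> b < 1 \<and> b < y}. {a<..b::real})"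
proof (intro equalityI subsetI)
  fix x assume x: "x \<in> {x\<in>{0<..<1}. x < y}"
  obtain b where b: "b \<in> \<rat>" "x < b" "b < min y 1"
    using Rats_dense_in_real[of x "min y 1"] x by auto
  obtain a where a: "a \<in> \<rat>" "0 < a" "a < x"
    using Rats_dense_in_real[of 0 x] x by auto
  show "x \<in> (\<Union>(a, b) \<in> {(a, b). a \<in> \<rat> \<and> b \<in> \<rat> \<and> 0 < a \<and> a \<le> b \<and> b < 1 \<and> b < y}. {a<..b})"
    using a b by (intro UN_I[of "(a, b)"]) auto
qed auto

lemma unit_greaterThan_eq_Union:
  "{x\<in>{0<..<1}. y < x} =
     (\<Union>(a, b) \<in> {(a, b). a \<in> \<rat> \<and> b \<in> \<rat> \<and> 0 < a \<and> a \<le> b \<and> b < 1 \<and> y < a}. {a..<b::real})"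
proof (intro equalityI subsetI)
  fix x assume x: "x \<in> {x\<in>{0<..<1}. y < x}"
  obtain b where b: "b \<in> \<rat>" "x < b" "b < 1"
    using Rats_dense_in_real[of x 1] x by auto
  obtain a where a: "a \<in> \<rat>" "max 0 y < a" "a < x"
    using Rats_dense_in_real[of "max 0 y" x] x by auto
  show "x \<in> (\<Union>(a, b) \<in> {(a, b). a \<in> \<rat> \<and> b \<in> \<rat> \<and> 0 < a \<and> a \<le> b \<and> b < 1 \<and> y < a}. {a..<b})"
    using a b by (intro UN_I[of "(a, b)"]) auto
qed auto

lemma countable_rat_pairs: "countable {(a, b). a \<in> \<rat> \<and> b \<in> \<rat> \<and> P a b}"
proof (rule countable_subset)
  show "{(a, b). a \<in> \<rat> \<and> b \<in> \<rat> \<and> P a b} \<subseteq> \<rat> \<times> \<rat>" by auto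
  show "countable (\<rat> \<times> \<rat>)" by (intro countable_SIGMA countable_rat)
qed

abbreviation unit_pairs :: "(real \<times> real) set" where
  "unit_pairs \<equiv> {(a, b). 0 < a \<and> a \<le> b \<and> b < 1}"

lemma sigma_sets_unit_Ioc:
  "sigma_sets {0<..<1} ((\<lambda>(a, b). {a<..b}) ` unit_pairs) = sets unit_borel"
  (is "sigma_sets _ ?G = _")
proof (rule antisym)
  have "?G \<subseteq> sets unit_borel"
    by (auto simp: sets_restrict_space_iff)
  then show "sigma_sets {0<..<1} ?G \<subseteq> sets unit_borel"
    using sets.sigma_sets_subset[of ?G unit_borel] by (simp add: space_restrict_space)
next
  interpret S: sigma_algebra "{0<..<1}" "sigma_sets {0<..<1} ?G"
    by (rule sigma_algebra_sigma_sets) auto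
  have "{x\<in>{0<..<1}. x < y} \<in> sigma_sets {0<..<1} ?G" for y
    unfolding unit_lessThan_eq_Union
    by (intro S.countable_UN' countable_rat_pairs) (auto intro!: sigma_sets.Basic image_eqI)
  then have "(\<lambda>x. x) \<in> borel_measurable (sigma {0<..<1::real} (sigma_sets {0<..<1} ?G))"
    using S.space_closed
    by (simp add: borel_measurable_iff_less sigma_sets_sigma_sets_eq space_measure_of)
  then show "sets unit_borel \<subseteq> sigma_sets {0<..<1} ?G"
    by (intro sets_unit_borel_subset S.sigma_algebra_axioms)
qed

lemma sigma_sets_unit_Ico:
  "sigma_sets {0<..<1} ((\<lambda>(a, b). {a..<b}) ` unit_pairs) = sets unit_borel"
  (is "sigma_sets _ ?G = _")
proof (rule antisym)
  have "?G \<subseteq> sets unit_borel"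
    by (auto simp: sets_restrict_space_iff)
  then show "sigma_sets {0<..<1} ?G \<subseteq> sets unit_borel"
    using sets.sigma_sets_subset[of ?G unit_borel] by (simp add: space_restrict_space)
next
  interpret S: sigma_algebra "{0<..<1}" "sigma_sets {0<..<1} ?G"
    by (rule sigma_algebra_sigma_sets) auto
  have "{x\<in>{0<..<1}. y < x} \<in> sigma_sets {0<..<1} ?G" for y
    unfolding unit_greaterThan_eq_Union
    by (intro S.countable_UN' countable_rat_pairs) (auto intro!: sigma_sets.Basic image_eqI)
  then have "(\<lambda>x. x) \<in> borel_measurable (sigma {0<..<1::real} (sigma_sets {0<..<1} ?G))"
    using S.space_closed
    by (simp add: borel_measurable_iff_greater sigma_sets_sigma_sets_eq space_measure_of)
  then show "sets unit_borel \<subseteq> sigma_sets {0<..<1} ?G"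
    by (intro sets_unit_borel_subset S.sigma_algebra_axioms)
qed

lemma Int_stable_unit_Ioc: "Int_stable ((\<lambda>(a, b). {a<..b}) ` unit_pairs)" (is "Int_stable ?E")
proof (rule Int_stableI)
  fix A B assume "A \<in> ?E" "B \<in> ?E"
  then obtain a b c d where *: "(a, b) \<in> unit_pairs" "(c, d) \<in> unit_pairs"
    and AB: "A = {a<..b}" "B = {c<..d}" by auto
  \<comment> \<open>The outer maximum turns an empty intersection into a degenerate interval, which
    \<open>unit_pairs\<close> admits.\<close>
  have "A \<inter> B = {max a c<..max (max a c) (min b d)}"
    unfolding AB by auto
  moreover have "(max a c, max (max a c) (min b d)) \<in> unit_pairs"
    using * by auto
  ultimately show "A \<inter> B \<in> ?E" by (intro image_eqI) auto
qed

text \<open>This holds for every F: \<open>extend_measure\<close> takes its sigma algebra from the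
  generators, even where no measure has the prescribed values.\<close>

lemma sets_stieltjes_rc [simp, measurable_cong]: "sets (stieltjes_measure_rc F) = sets unit_borel"
  unfolding stieltjes_measure_rc_def
  by (subst sets_extend_measure) (auto simp: sigma_sets_unit_Ioc[simplified])

lemma sets_stieltjes_lc [simp, measurable_cong]: "sets (stieltjes_measure_lc F) = sets unit_borel"
  unfolding stieltjes_measure_lc_def
  by (subst sets_extend_measure) (auto simp: sigma_sets_unit_Ico[simplified])

lemma space_stieltjes_rc [simp]: "space (stieltjes_measure_rc F) = {0<..<1}"
  using sets_eq_imp_space_eq[OF sets_stieltjes_rc] by (simp add: space_restrict_space)

lemma space_stieltjes_lc [simp]: "space (stieltjes_measure_lc F) = {0<..<1}"
  using sets_eq_imp_space_eq[OF sets_stieltjes_lc] by (simp add: space_restrict_space)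

section \<open>Existence of the Stieltjes measures\<close>

text \<open>The image of Lebesgue measure under the generalized inverse of \<open>F\<close>.\<close>

lemma ex_stieltjes_measure_rc:
  assumes F: "incr_rc F"
  obtains N where "sets N = sets unit_borel"
    "\<And>a b. 0 < a \<Longrightarrow> a \<le> b \<Longrightarrow> b < 1 \<Longrightarrow> emeasure N {a<..b} = ennreal (F b - F a)"
proof -
  \<comment> \<open>The levels that F exceeds somewhere and stays strictly below somewhere else
    would be the open range; keeping equality on the right includes an attained supremum. On R the
    generalized inverse T stays inside the open unit interval.\<close>
  define R where "R = {y. \<exists>a\<in>{0<..<1}. \<exists>b\<in>{0<..<1}. F a < y \<and> y \<le> F b}"
  define S where "S y = {u\<in>{0<..<1}. y \<le> F u}" for y
  define T where "T y = Inf (S y)" for y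
  have mono: "F u \<le> F v" if "u \<in> {0<..<1}" "v \<in> {0<..<1}" "u \<le> v" for u v
    using mono_onD[OF incr_rcD(1)[OF F]] that by blast
  have bdd: "bdd_below (S y)" for y
    by (rule bdd_belowI[of _ 0]) (auto simp: S_def)
  have T_unit: "T y \<in> {0<..<1}" if "y \<in> R" for y
  proof -
    obtain a b where ab: "a \<in> {0<..<1}" "b \<in> {0<..<1}" "F a < y" "y \<le> F b"
      using \<open>y \<in> R\<close> by (auto simp: R_def)
    have "a \<le> T y" unfolding T_def
    proof (rule cInf_greatest)
      show "S y \<noteq> {}" using ab by (auto simp: S_def)
      fix x assume x: "x \<in> S y"
      show "a \<le> x"
      proof (rule ccontr)
        assume "\<not> a \<le> x"
        then have "F x \<le> F a" using x ab by (intro mono) (auto simp: S_def)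
        then show False using x ab by (simp add: S_def)
      qed
    qed
    moreover have "T y \<le> b"
      unfolding T_def using ab by (intro cInf_lower bdd) (auto simp: S_def)
    ultimately show ?thesis using ab by auto
  qed
  \<comment> \<open>The Galois connection between T and F, where right-continuity enters. Applied at
    both ends of \<open>{a<..b}\<close> it computes the preimage of that interval under T.\<close>
  have T_le: "T y \<le> u \<longleftrightarrow> y \<le> F u" if "y \<in> R" "u \<in> {0<..<1}" for y u
  proof
    assume "y \<le> F u"
    then show "T y \<le> u"
      unfolding T_def using that by (intro cInf_lower bdd) (auto simp: S_def)
  next
    assume Tu: "T y \<le> u"
    have ge: "y \<le> F v" if "v \<in> {u<..<1}" for v
    proof -
      have "T y < v" using Tu that by auto
      moreover have "S y \<noteq> {}" using \<open>y \<in> R\<close> by (auto simp: S_def R_def)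
      ultimately obtain w where "w \<in> S y" "w < v"
        unfolding T_def by (meson bdd cInf_less_iff)
      then have "F w \<le> F v" using that \<open>u \<in> _\<close> by (intro mono) (auto simp: S_def)
      then show ?thesis using \<open>w \<in> S y\<close> by (simp add: S_def)
    qed
    have "(F \<longlongrightarrow> F u) (at_right u)"
      using incr_rcD(2)[OF F] that by (simp add: continuous_within)
    moreover have "eventually (\<lambda>v. y \<le> F v) (at_right u)"
      using that by (intro eventually_at_rightI[of u 1] ge) auto
    ultimately show "y \<le> F u"
      by (intro tendsto_lowerbound[of F _ "at_right u"]) auto
  qed
  \<comment> \<open>A countable union of intervals gives Borel measurability of R without asking
    whether the infimum and supremum of F are finite or attained.\<close>
  have "R = (\<Union>(a, b) \<in> {(a, b). a \<in> \<rat> \<and> b \<in> \<rat> \<and> a \<in> {0<..<1} \<and> b \<in> {0<..<1}}. {F a<..F b})"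
    (is "_ = ?R")
  proof
    show "R \<subseteq> ?R"
    proof
      fix y assume "y \<in> R"
      then obtain a b where ab: "a \<in> {0<..<1}" "b \<in> {0<..<1}" "F a < y" "y \<le> F b"
        by (auto simp: R_def)
      obtain a' where a': "a' \<in> \<rat>" "0 < a'" "a' < a"
        using Rats_dense_in_real[of 0 a] ab by auto
      obtain b' where b': "b' \<in> \<rat>" "b < b'" "b' < 1"
        using Rats_dense_in_real[of b 1] ab by auto
      have "F a' \<le> F a" "F b \<le> F b'" using a' b' ab by (auto intro!: mono)
      then show "y \<in> ?R" using a' b' ab by (intro UN_I[of "(a', b')"]) auto
    qed
  qed (auto simp: R_def)
  also have "\<dots> \<in> sets borel"
    by (intro sets.countable_UN' countable_rat_pairs) auto
  finally have R [measurable]: "R \<in> sets borel" .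
  have "mono_on R T"
  proof (rule mono_onI)
    fix x y assume "x \<in> R" "y \<in> R" "x \<le> y"
    then show "T x \<le> T y"
      unfolding T_def by (intro cInf_superset_mono bdd) (auto simp: S_def R_def)
  qed
  then have "T \<in> borel_measurable (restrict_space borel R)"
    by (rule borel_measurable_mono_on_fnc)
  then have "T \<in> measurable (restrict_space borel R) unit_borel"
    using T_unit by (intro measurable_restrict_space2) (auto simp: space_restrict_space)
  then have T: "T \<in> measurable (restrict_space lborel R) unit_borel"
    by (subst measurable_cong_sets) (auto simp: sets_restrict_space)
  define N where "N = distr (restrict_space lborel R) unit_borel T"
  show ?thesis
  proof
    show "sets N = sets unit_borel" by (simp add: N_def)
    fix a b :: real assume ab: "0 < a" "a \<le> b" "b < 1"
    have "T -` {a<..b} \<inter> R = {F a<..F b}"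
      using T_le[of _ a] T_le[of _ b] ab by (force simp: R_def not_le[symmetric])
    moreover have "{a<..b} \<in> sets unit_borel"
      using ab by (auto simp: sets_restrict_space_iff)
    ultimately have "emeasure N {a<..b} = emeasure (restrict_space lborel R) {F a<..F b}"
      unfolding N_def by (subst emeasure_distr[OF T]) (auto simp: space_restrict_space)
    also have "{F a<..F b} \<subseteq> R"
      using ab by (auto simp: R_def)
    then have "emeasure (restrict_space lborel R) {F a<..F b} = emeasure lborel {F a<..F b}"
      by (intro emeasure_restrict_space) auto
    finally show "emeasure N {a<..b} = ennreal (F b - F a)"
      using mono[of a b] ab by simp
  qed
qed

text \<open>\<open>extend_measure\<close> attains the prescribed values as soon as some measure on
  the same sigma algebra does, and the image measure just constructed is a witness.\<close>

lemma emeasure_stieltjes_rc: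
  assumes "incr_rc F" "0 < a" "a \<le> b" "b < 1"
  shows "emeasure (stieltjes_measure_rc F) {a<..b} = ennreal (F b - F a)"
proof -
  obtain N where N: "sets N = sets unit_borel"
    "\<And>a b. 0 < a \<Longrightarrow> a \<le> b \<Longrightarrow> b < 1 \<Longrightarrow> emeasure N {a<..b} = ennreal (F b - F a)"
    using ex_stieltjes_measure_rc[OF assms(1)] by metis
  have s: "sets (stieltjes_measure_rc F) = sets N" using N(1) by simp
  have "(\<lambda>(x, y). {x<..y}) ` unit_pairs \<subseteq> Pow {0<..<1}" by auto
  then show ?thesis
    using emeasure_extend_measure[OF stieltjes_measure_rc_def, of "emeasure N" F "(a, b)"] assms(2-)
      N(2) emeasure_positive[of N] emeasure_countably_additive[of N] s
    by auto
qed

text \<open>The reflection \<open>1 - u\<close> reduces this to the right-continuous case: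
  \<open>- F (1 - u)\<close> is increasing and right-continuous, and \<open>{a..<b}\<close> is the
  mirror image of \<open>{1 - b<..1 - a}\<close>.\<close>

lemma emeasure_stieltjes_lc:
  assumes F: "incr_lc F"
    and ab: "0 < a" "a \<le> b" "b < 1"
  shows "emeasure (stieltjes_measure_lc F) {a..<b} = ennreal (F b - F a)"
proof -
  define F' where "F' u = - F (1 - u)" for u
  have "incr_rc F'"
    unfolding incr_rc_def
  proof (intro conjI ballI mono_onI)
    fix u v :: real assume "u \<in> {0<..<1}" "v \<in> {0<..<1}" "u \<le> v"
    then show "F' u \<le> F' v"
      using mono_onD[OF incr_lcD(1)[OF F], of "1 - v" "1 - u"] by (simp add: F'_def)
  next
    fix u :: real assume u: "u \<in> {0<..<1}"
    have "filterlim (\<lambda>x. 1 - x) (at_left (1 - u)) (at_right u)"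
      unfolding filterlim_at by (auto intro!: tendsto_intros eventually_at_rightI[of u "u+1"])
    moreover have "(F \<longlongrightarrow> F (1 - u)) (at_left (1 - u))"
      using incr_lcD(2)[OF F, of "1 - u"] u by (simp add: continuous_within)
    ultimately show "continuous (at_right u) F'"
      unfolding F'_def continuous_within
      by (intro tendsto_minus) (rule filterlim_compose)
  qed
  define N where "N = distr (stieltjes_measure_rc F') unit_borel (\<lambda>u. 1 - u)"
  have m: "(\<lambda>u. 1 - u) \<in> measurable (stieltjes_measure_rc F') unit_borel"
  proof (rule measurable_restrict_space2)
    show "(\<lambda>u. 1 - u) \<in> borel_measurable (stieltjes_measure_rc F')"
      by (subst measurable_cong_sets[OF sets_stieltjes_rc refl])
        (intro measurable_restrict_space1 borel_measurable_diff; simp)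
  qed auto
  have N: "emeasure N {a..<b} = ennreal (F b - F a)" if "0 < a" "a \<le> b" "b < 1" for a b
  proof -
    have "{a..<b} \<in> sets unit_borel"
      using that by (auto simp: sets_restrict_space_iff)
    then have "emeasure N {a..<b} = emeasure (stieltjes_measure_rc F') ((\<lambda>u. 1 - u) -` {a..<b} \<inter> {0<..<1})"
      unfolding N_def by (subst emeasure_distr[OF m]) auto
    also have "(\<lambda>u. 1 - u) -` {a..<b} \<inter> {0<..<1} = {1 - b<..1 - a}"
      using that by auto
    also have "emeasure (stieltjes_measure_rc F') \<dots> = ennreal (F' (1 - a) - F' (1 - b))"
      using that by (intro emeasure_stieltjes_rc \<open>incr_rc F'\<close>) auto
    finally show ?thesis by (simp add: F'_def)
  qed
  have s: "sets (stieltjes_measure_lc F) = sets N" by (simp add: N_def)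
  have "(\<lambda>(x, y). {x..<y}) ` unit_pairs \<subseteq> Pow {0<..<1}" by auto
  then show ?thesis
    using emeasure_extend_measure[OF stieltjes_measure_lc_def, of "emeasure N" F "(a, b)"] ab
      N emeasure_positive[of N] emeasure_countably_additive[of N] s
    by auto
qed

section \<open>Exhaustion of the unit interval, uniqueness and sigma-finiteness\<close>

lemma Ioc_in_sets_unit [simp, intro]:
  "0 \<le> a \<Longrightarrow> b < 1 \<Longrightarrow> {a<..b} \<in> sets unit_borel"
  "0 < a \<Longrightarrow> b \<le> 1 \<Longrightarrow> {a..<b} \<in> sets unit_borel" for a b :: real
  by (auto simp: sets_restrict_space_iff)

text \<open>The offset 2 keeps the value at most 1/2, so that
  \<open>(cutoff n, 1 - cutoff n)\<close> lies in \<open>unit_pairs\<close> already for n = 0. The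
  resulting intervals have finite mass even if F is unbounded at 0 or 1.\<close>

definition cutoff :: "nat \<Rightarrow> real" where
  "cutoff n = 1 / real (n + 2)"

lemma cutoff_pos [simp]: "0 < cutoff n"
  by (simp add: cutoff_def)

lemma cutoff_le_half: "cutoff n \<le> 1 / 2"
  unfolding cutoff_def by (intro divide_left_mono) auto

lemma cutoff_less: "0 < x \<Longrightarrow> \<exists>n. cutoff n < x"
proof -
  assume "0 < x"
  then obtain n where "1 / real (Suc n) < x"
    using nat_approx_posE by auto
  moreover have "cutoff n \<le> 1 / real (Suc n)"
    unfolding cutoff_def by (intro divide_left_mono) auto
  ultimately show ?thesis by (intro exI[of _ n]) auto
qed

lemma cutoff_pairs: "0 < cutoff n" "cutoff n \<le> 1 - cutoff n" "1 - cutoff n < 1"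
  using cutoff_pos[of n] cutoff_le_half[of n] by auto

lemma unit_exhaustion:
  "(\<Union>n. {cutoff n<..1 - cutoff n}) = {0<..<1}" "(\<Union>n. {cutoff n..<1 - cutoff n}) = {0<..<1}"
proof -
  have 1: "\<exists>n. cutoff n < x \<and> x < 1 - cutoff n" if "0 < x" "x < 1" for x
    using cutoff_less[of "min x (1 - x)"] that by auto
  have 2: "0 < x \<and> x < 1" if "cutoff n \<le> x" "x \<le> 1 - cutoff n" for n x
    using cutoff_pos[of n] that by linarith
  show "(\<Union>n. {cutoff n<..1 - cutoff n}) = {0<..<1}"
    by (rule set_eqI) (simp, meson 1 2 less_imp_le)
  show "(\<Union>n. {cutoff n..<1 - cutoff n}) = {0<..<1}"
    by (rule set_eqI) (simp, meson 1 2 less_imp_le)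
qed

text \<open>Uniqueness on an intersection-stable generator, with the exhausting intervals as sets of
  finite mass. The identities between right-continuous Stieltjes measures below are all reduced to
  increments in this way.\<close>

lemma stieltjes_rc_eqI:
  assumes F: "incr_rc F" and M: "sets M = sets unit_borel"
    and eq: "\<And>a b. 0 < a \<Longrightarrow> a \<le> b \<Longrightarrow> b < 1 \<Longrightarrow> emeasure M {a<..b} = ennreal (F b - F a)"
  shows "M = stieltjes_measure_rc F"
proof (rule measure_eqI_generator_eq)
  let ?E = "(\<lambda>(a, b). {a<..b}) ` unit_pairs"
  show "Int_stable ?E" by (rule Int_stable_unit_Ioc)
  show "?E \<subseteq> Pow {0<..<1}" by auto
  show "emeasure M X = emeasure (stieltjes_measure_rc F) X" if "X \<in> ?E" for X
    using that eq emeasure_stieltjes_rc[OF F] by auto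
  show "sets M = sigma_sets {0<..<1} ?E" "sets (stieltjes_measure_rc F) = sigma_sets {0<..<1} ?E"
    by (simp_all add: sigma_sets_unit_Ioc M)
  show "(\<Union>n. {cutoff n<..1 - cutoff n}) = {0<..<1}"
    by (rule unit_exhaustion)
  show "range (\<lambda>n. {cutoff n<..1 - cutoff n}) \<subseteq> ?E"
  proof safe
    fix n show "{cutoff n<..1 - cutoff n} \<in> ?E"
      using cutoff_pairs[of n] by (intro image_eqI[of _ _ "(cutoff n, 1 - cutoff n)"]) auto
  qed
  show "emeasure M {cutoff n<..1 - cutoff n} \<noteq> \<infinity>" for n
    using cutoff_pairs[of n] by (subst eq) auto
qed

lemma sigma_finite_stieltjes_rc:
  assumes "incr_rc F"
  shows "sigma_finite_measure (stieltjes_measure_rc F)"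
proof
  let ?A = "range (\<lambda>n. {cutoff n<..1 - cutoff n})"
  have "emeasure (stieltjes_measure_rc F) {cutoff n<..1 - cutoff n} \<noteq> \<infinity>" for n
    using cutoff_pairs[of n] by (subst emeasure_stieltjes_rc[OF assms]) auto
  then show "\<exists>A. countable A \<and> A \<subseteq> sets (stieltjes_measure_rc F) \<and>
      \<Union> A = space (stieltjes_measure_rc F) \<and> (\<forall>a\<in>A. emeasure (stieltjes_measure_rc F) a \<noteq> \<infinity>)"
    using unit_exhaustion by (intro exI[of _ ?A]) (auto simp: less_imp_le)
qed

lemma sigma_finite_stieltjes_lc:
  assumes "incr_lc F"
  shows "sigma_finite_measure (stieltjes_measure_lc F)"
proof
  let ?A = "range (\<lambda>n. {cutoff n..<1 - cutoff n})"
  have "emeasure (stieltjes_measure_lc F) {cutoff n..<1 - cutoff n} \<noteq> \<infinity>" for n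
    using cutoff_pairs[of n] by (subst emeasure_stieltjes_lc[OF assms]) auto
  then show "\<exists>A. countable A \<and> A \<subseteq> sets (stieltjes_measure_lc F) \<and>
      \<Union> A = space (stieltjes_measure_lc F) \<and> (\<forall>a\<in>A. emeasure (stieltjes_measure_lc F) a \<noteq> \<infinity>)"
    using unit_exhaustion by (intro exI[of _ ?A]) (auto simp: less_imp_le)
qed

section \<open>Lebesgue--Stieltjes integrals\<close>

lemma incr_rc_add:
  assumes F: "incr_rc F" and G: "incr_rc G" shows "incr_rc (\<lambda>u. F u + G u)"
  unfolding incr_rc_def
proof (intro conjI ballI mono_onI)
  fix u v :: real assume "u \<in> {0<..<1}" "v \<in> {0<..<1}" "u \<le> v"
  then show "F u + G u \<le> F v + G v"
    using mono_onD[OF incr_rcD(1)[OF F]] mono_onD[OF incr_rcD(1)[OF G]] by (intro add_mono)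
qed (intro continuous_add incr_rcD(2) F G)

lemma incr_rc_cmult:
  assumes F: "incr_rc F" and "0 \<le> c" shows "incr_rc (\<lambda>u. c * F u)"
  unfolding incr_rc_def
proof (intro conjI ballI mono_onI)
  fix u v :: real assume "u \<in> {0<..<1}" "v \<in> {0<..<1}" "u \<le> v"
  then show "c * F u \<le> c * F v"
    using mono_onD[OF incr_rcD(1)[OF F]] \<open>0 \<le> c\<close> by (intro mult_left_mono)
qed (intro continuous_mult continuous_const incr_rcD(2) F)

lemma incr_rc_le: "incr_rc F \<Longrightarrow> 0 < a \<Longrightarrow> a \<le> b \<Longrightarrow> b < 1 \<Longrightarrow> F a \<le> F b"
  by (rule mono_onD[OF incr_rcD(1)]) auto

lemma stieltjes_rc_cong:
  assumes "incr_rc F" "incr_rc G" "\<And>u. u \<in> {0<..<1} \<Longrightarrow> F u = G u"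
  shows "stieltjes_measure_rc F = stieltjes_measure_rc G"
  using assms by (intro stieltjes_rc_eqI) (auto simp: emeasure_stieltjes_rc)

text \<open>The setwise sum of the two measures is itself a measure, and its values on
  \<open>{a<..b}\<close> are the increments of F + G; uniqueness does the rest.\<close>

lemma emeasure_stieltjes_rc_add:
  assumes F: "incr_rc F" and G: "incr_rc G" and A: "A \<in> sets unit_borel"
  shows "emeasure (stieltjes_measure_rc (\<lambda>u. F u + G u)) A =
    emeasure (stieltjes_measure_rc F) A + emeasure (stieltjes_measure_rc G) A"
proof -
  define \<mu> where "\<mu> A = emeasure (stieltjes_measure_rc F) A + emeasure (stieltjes_measure_rc G) A" for A
  define N where "N = measure_of {0<..<1} (sets unit_borel) \<mu>"
  have sub: "sets unit_borel \<subseteq> Pow {0<..<1}"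
    by (auto simp: sets_restrict_space)
  have alg: "sigma_algebra {0<..<1} (sets unit_borel)"
    using sets.sigma_algebra_axioms[of unit_borel] by (simp add: space_restrict_space)
  have N_sets: "sets N = sets unit_borel"
    unfolding N_def using sub sigma_algebra.sigma_sets_eq[OF alg] by simp
  have "positive (sets N) \<mu>"
    by (simp add: positive_def \<mu>_def)
  moreover have "countably_additive (sets N) \<mu>"
  proof (rule countably_additiveI)
    fix B :: "nat \<Rightarrow> real set"
    assume "range B \<subseteq> sets N" "disjoint_family B" "(\<Union>i. B i) \<in> sets N"
    then show "(\<Sum>i. \<mu> (B i)) = \<mu> (\<Union>i. B i)"
      unfolding \<mu>_def N_sets by (subst suminf_add[symmetric]) (auto simp: suminf_emeasure)
  qed
  ultimately have em: "emeasure N B = \<mu> B" if "B \<in> sets unit_borel" for B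
    using that sub N_sets by (intro emeasure_measure_of[OF N_def]) auto
  have "N = stieltjes_measure_rc (\<lambda>u. F u + G u)"
  proof (rule stieltjes_rc_eqI[OF incr_rc_add[OF F G] N_sets])
    fix a b :: real assume ab: "0 < a" "a \<le> b" "b < 1"
    then have "emeasure N {a<..b} = ennreal (F b - F a) + ennreal (G b - G a)"
      by (simp add: em \<mu>_def emeasure_stieltjes_rc F G)
    also have "\<dots> = ennreal (F b + G b - (F a + G a))"
      using incr_rc_le[OF F ab] incr_rc_le[OF G ab] by (simp flip: ennreal_plus)
    finally show "emeasure N {a<..b} = ennreal (F b + G b - (F a + G a))" .
  qed
  with em[OF A] show ?thesis by (simp add: \<mu>_def)
qed

lemma measurable_stieltjes_rc [simp]:
  "borel_measurable (stieltjes_measure_rc F) = borel_measurable unit_borel"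
  by (intro measurable_cong_sets) auto

lemma measurable_stieltjes_lc [simp]:
  "borel_measurable (stieltjes_measure_lc F) = borel_measurable unit_borel"
  by (intro measurable_cong_sets) auto

lemma nn_integral_stieltjes_rc_add:
  assumes F: "incr_rc F" and G: "incr_rc G" and f: "f \<in> borel_measurable unit_borel"
  shows "(\<integral>\<^sup>+ u. f u \<partial>stieltjes_measure_rc (\<lambda>u. F u + G u)) =
    (\<integral>\<^sup>+ u. f u \<partial>stieltjes_measure_rc F) + (\<integral>\<^sup>+ u. f u \<partial>stieltjes_measure_rc G)"
  using f
proof (induction rule: borel_measurable_induct)
  case (cong f g)
  have "(\<integral>\<^sup>+ u. f u \<partial>stieltjes_measure_rc H) = (\<integral>\<^sup>+ u. g u \<partial>stieltjes_measure_rc H)" for H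
    using cong(3) by (intro nn_integral_cong) (simp add: space_restrict_space)
  with cong show ?case by simp
next
  case (set A)
  then show ?case by (simp add: emeasure_stieltjes_rc_add[OF F G])
next
  case (mult u c)
  then show ?case by (simp add: nn_integral_cmult distrib_left)
next
  case (add u v)
  then show ?case by (simp add: nn_integral_add ac_simps)
next
  case (seq U)
  have *: "(\<integral>\<^sup>+ u. (SUP i. U i u) \<partial>stieltjes_measure_rc H) = (SUP i. \<integral>\<^sup>+ u. U i u \<partial>stieltjes_measure_rc H)" for H
    using seq by (intro nn_integral_monotone_convergence_SUP) auto
  have "incseq (\<lambda>i. \<integral>\<^sup>+ u. U i u \<partial>stieltjes_measure_rc H)" for H
    using seq by (intro incseq_SucI nn_integral_mono) (auto simp: incseq_Suc_iff le_fun_def)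
  then show ?case
    using seq unfolding SUP_apply * by (simp add: ennreal_SUP_add)
qed

text \<open>A sum of nonnegative integrals is finite only if both are. The direction from the sum to
  its summands later makes a Lebesgue integrable function integrable against both parts of a
  Lipschitz integrator.\<close>

lemma integrable_stieltjes_rc_add:
  fixes f :: "real \<Rightarrow> real"
  assumes F: "incr_rc F" and G: "incr_rc G"
  shows "integrable (stieltjes_measure_rc (\<lambda>u. F u + G u)) f \<longleftrightarrow>
    integrable (stieltjes_measure_rc F) f \<and> integrable (stieltjes_measure_rc G) f"
  unfolding integrable_iff_bounded using nn_integral_stieltjes_rc_add[OF F G, of "\<lambda>u. norm (f u)"]
  by auto

lemma integral_stieltjes_rc_add:
  fixes f :: "real \<Rightarrow> real"
  assumes F: "incr_rc F" and G: "incr_rc G"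
    and f: "integrable (stieltjes_measure_rc F) f" "integrable (stieltjes_measure_rc G) f"
  shows "(LINT u|stieltjes_measure_rc (\<lambda>u. F u + G u). f u) =
    (LINT u|stieltjes_measure_rc F. f u) + (LINT u|stieltjes_measure_rc G. f u)"
proof -
  have [measurable]: "f \<in> borel_measurable unit_borel"
    using f(1) by (auto dest: borel_measurable_integrable)
  have fin: "(\<integral>\<^sup>+ u. ennreal (f u) \<partial>stieltjes_measure_rc H) < \<infinity>"
    "(\<integral>\<^sup>+ u. ennreal (- f u) \<partial>stieltjes_measure_rc H) < \<infinity>"
    if "integrable (stieltjes_measure_rc H) f" for H
    using that by (auto simp: real_integrable_def less_top)
  have "integrable (stieltjes_measure_rc (\<lambda>u. F u + G u)) f"
    using f integrable_stieltjes_rc_add[OF F G] by simp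
  then show ?thesis
    using f fin by (simp add: real_lebesgue_integral_def nn_integral_stieltjes_rc_add[OF F G] enn2real_plus)
qed

lemma stieltjes_rc_cmult:
  assumes F: "incr_rc F" and c: "0 \<le> c"
  shows "density (stieltjes_measure_rc F) (\<lambda>_. ennreal c) = stieltjes_measure_rc (\<lambda>u. c * F u)"
proof (rule stieltjes_rc_eqI[OF incr_rc_cmult[OF assms]])
  fix a b :: real assume ab: "0 < a" "a \<le> b" "b < 1"
  then have "emeasure (density (stieltjes_measure_rc F) (\<lambda>_. ennreal c)) {a<..b} =
      ennreal c * ennreal (F b - F a)"
    by (subst emeasure_density_const) (auto simp: emeasure_stieltjes_rc F)
  then show "emeasure (density (stieltjes_measure_rc F) (\<lambda>_. ennreal c)) {a<..b} = ennreal (c * F b - c * F a)"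
    using c incr_rc_le[OF F ab] by (simp add: right_diff_distrib flip: ennreal_mult)
qed simp

lemma integral_stieltjes_rc_cmult:
  fixes f :: "real \<Rightarrow> real"
  assumes F: "incr_rc F" and c: "0 \<le> c" and f: "integrable (stieltjes_measure_rc F) f"
  shows "integrable (stieltjes_measure_rc (\<lambda>u. c * F u)) f"
    and "(LINT u|stieltjes_measure_rc (\<lambda>u. c * F u). f u) = c * (LINT u|stieltjes_measure_rc F. f u)"
  unfolding stieltjes_rc_cmult[OF F c, symmetric]
  using f c borel_measurable_integrable[OF f]
  by (auto simp: integrable_real_density integral_real_density)

lemma has_LS_integral_unit_iff:
  "has_LS_integral f \<kappa> {0<..<1} I \<longleftrightarrow>
     (\<exists>G H. incr_rc G \<and> incr_rc H \<and> (\<forall>u\<in>{0<..<1}. \<kappa> u = G u - H u) \<and>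
        integrable (stieltjes_measure_rc G) f \<and> integrable (stieltjes_measure_rc H) f \<and>
        I = (LINT u|stieltjes_measure_rc G. f u) - (LINT u|stieltjes_measure_rc H. f u))"
proof -
  have "set_integrable (stieltjes_measure_rc G) {0<..<1} f \<longleftrightarrow> integrable (stieltjes_measure_rc G) f"
    "(LINT u:{0<..<1}|stieltjes_measure_rc G. f u) = (LINT u|stieltjes_measure_rc G. f u)" for G
    unfolding set_integrable_def set_lebesgue_integral_def
    by (auto intro!: Bochner_Integration.integrable_cong Bochner_Integration.integral_cong)
  then show ?thesis unfolding has_LS_integral_def by simp
qed

text \<open>Moving the set into the integrand lets every later argument work with plain integrals
  over one fixed space.\<close>

lemma has_LS_integral_indicator:
  "has_LS_integral f \<kappa> A I \<longleftrightarrow> has_LS_integral (\<lambda>u. indicator A u * f u) \<kappa> {0<..<1} I"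
  unfolding has_LS_integral_unit_iff unfolding has_LS_integral_def
  by (simp add: set_integrable_def set_lebesgue_integral_def)

lemma has_LS_integralE:
  assumes "has_LS_integral f \<kappa> A I"
  obtains G H where "incr_rc G" "incr_rc H" "\<forall>u\<in>{0<..<1}. \<kappa> u = G u - H u"
    "integrable (stieltjes_measure_rc G) (\<lambda>u. indicator A u * f u)"
    "integrable (stieltjes_measure_rc H) (\<lambda>u. indicator A u * f u)"
    "I = (LINT u|stieltjes_measure_rc G. indicator A u * f u) -
         (LINT u|stieltjes_measure_rc H. indicator A u * f u)"
  using assms unfolding has_LS_integral_indicator[of f] has_LS_integral_unit_iff by blast

text \<open>From G - H = G' - H' one gets G + H' = G' + H. Here both sides are increasing, so they
  have the same Stieltjes measure and additivity in the integrator compares the integrals. This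
  justifies the definite description in \<open>LS_integral\<close>.\<close>

lemma has_LS_integral_unique:
  assumes "has_LS_integral f \<kappa> A I" "has_LS_integral f \<kappa> A J"
  shows "I = J"
proof -
  let ?f = "\<lambda>u. indicator A u * f u"
  let ?S = stieltjes_measure_rc
  obtain G H where GH: "incr_rc G" "incr_rc H" "\<forall>u\<in>{0<..<1}. \<kappa> u = G u - H u"
    "integrable (?S G) ?f" "integrable (?S H) ?f"
    "I = (LINT u|?S G. ?f u) - (LINT u|?S H. ?f u)"
    by (rule has_LS_integralE[OF assms(1)])
  obtain G' H' where GH': "incr_rc G'" "incr_rc H'" "\<forall>u\<in>{0<..<1}. \<kappa> u = G' u - H' u"
    "integrable (?S G') ?f" "integrable (?S H') ?f"
    "J = (LINT u|?S G'. ?f u) - (LINT u|?S H'. ?f u)"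
    by (rule has_LS_integralE[OF assms(2)])
  have "G u + H' u = G' u + H u" if "u \<in> {0<..<1}" for u
    using bspec[OF GH(3) that] bspec[OF GH'(3) that] by linarith
  then have "?S (\<lambda>u. G u + H' u) = ?S (\<lambda>u. G' u + H u)"
    by (intro stieltjes_rc_cong incr_rc_add GH GH')
  then have "(LINT u|?S G. ?f u) + (LINT u|?S H'. ?f u) = (LINT u|?S G'. ?f u) + (LINT u|?S H. ?f u)"
    using integral_stieltjes_rc_add[of G H' ?f] integral_stieltjes_rc_add[of G' H ?f] GH GH' by simp
  then show ?thesis using GH(6) GH'(6) by linarith
qed

lemma LS_integral_eq: "has_LS_integral f \<kappa> A I \<Longrightarrow> LS_integral f \<kappa> A = I"
  unfolding LS_integral_def using has_LS_integral_unique by blast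

lemma has_LS_integral_LS_integral: "LS_integrable f \<kappa> A \<Longrightarrow> has_LS_integral f \<kappa> A (LS_integral f \<kappa> A)"
  unfolding LS_integrable_def using LS_integral_eq by blast

lemma has_LS_integral_add_integrator:
  assumes "has_LS_integral f \<kappa> A I" "has_LS_integral f \<eta> A J"
  shows "has_LS_integral f (\<lambda>u. \<kappa> u + \<eta> u) A (I + J)"
proof -
  let ?f = "\<lambda>u. indicator A u * f u"
  let ?S = stieltjes_measure_rc
  obtain G H where GH: "incr_rc G" "incr_rc H" "\<forall>u\<in>{0<..<1}. \<kappa> u = G u - H u"
    "integrable (?S G) ?f" "integrable (?S H) ?f"
    "I = (LINT u|?S G. ?f u) - (LINT u|?S H. ?f u)"
    by (rule has_LS_integralE[OF assms(1)])
  obtain G' H' where GH': "incr_rc G'" "incr_rc H'" "\<forall>u\<in>{0<..<1}. \<eta> u = G' u - H' u"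
    "integrable (?S G') ?f" "integrable (?S H') ?f"
    "J = (LINT u|?S G'. ?f u) - (LINT u|?S H'. ?f u)"
    by (rule has_LS_integralE[OF assms(2)])
  show ?thesis
    unfolding has_LS_integral_indicator[of f] has_LS_integral_unit_iff
  proof (intro exI conjI ballI)
    show "incr_rc (\<lambda>u. G u + G' u)" "incr_rc (\<lambda>u. H u + H' u)"
      by (intro incr_rc_add GH GH')+
  qed (use GH GH' in \<open>simp_all add: integrable_stieltjes_rc_add integral_stieltjes_rc_add\<close>)
qed

lemma has_LS_integral_cmult_integrator:
  assumes "has_LS_integral f \<kappa> A I"
  shows "has_LS_integral f (\<lambda>u. c * \<kappa> u) A (c * I)"
proof -
  let ?f = "\<lambda>u. indicator A u * f u"
  let ?S = stieltjes_measure_rc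
  obtain G H where GH: "incr_rc G" "incr_rc H" "\<forall>u\<in>{0<..<1}. \<kappa> u = G u - H u"
    "integrable (?S G) ?f" "integrable (?S H) ?f"
    "I = (LINT u|?S G. ?f u) - (LINT u|?S H. ?f u)"
    by (rule has_LS_integralE[OF assms])
  have incr: "incr_rc (\<lambda>u. \<bar>c\<bar> * G u)" "incr_rc (\<lambda>u. \<bar>c\<bar> * H u)"
    by (intro incr_rc_cmult GH abs_ge_zero)+
  show ?thesis
  proof (cases "0 \<le> c")
    case True
    show ?thesis
      unfolding has_LS_integral_indicator[of f] has_LS_integral_unit_iff
      by (intro exI[of _ "\<lambda>u. \<bar>c\<bar> * G u"] exI[of _ "\<lambda>u. \<bar>c\<bar> * H u"])
        (use GH incr True in \<open>auto simp: integral_stieltjes_rc_cmult right_diff_distrib\<close>)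
  next
    \<comment> \<open>A negative factor exchanges the roles of the two increasing parts.\<close>
    case False
    show ?thesis
      unfolding has_LS_integral_indicator[of f] has_LS_integral_unit_iff
      by (intro exI[of _ "\<lambda>u. \<bar>c\<bar> * H u"] exI[of _ "\<lambda>u. \<bar>c\<bar> * G u"])
        (use GH incr False integral_stieltjes_rc_cmult[of _ "-c"] in \<open>auto simp: right_diff_distrib\<close>)
  qed
qed

lemma has_LS_integral_diff_integrator:
  assumes "has_LS_integral f \<kappa> A I" "has_LS_integral f \<eta> A J"
  shows "has_LS_integral f (\<lambda>u. \<kappa> u - \<eta> u) A (I - J)"
  using has_LS_integral_add_integrator[OF assms(1) has_LS_integral_cmult_integrator[OF assms(2), of "-1"]]
  by simp

section \<open>Lipschitz integrators\<close>

abbreviation unit_lborel :: "real measure" where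
  "unit_lborel \<equiv> restrict_space lborel {0<..<1}"

lemma set_integrable_unit_iff:
  fixes f :: "real \<Rightarrow> real"
  shows "set_integrable lborel {0<..<1} f \<longleftrightarrow> integrable unit_lborel f"
  unfolding set_integrable_def by (subst integrable_restrict_space) auto

lemma set_integral_unit_eq:
  fixes f :: "real \<Rightarrow> real"
  shows "(LINT u:{0<..<1}|lborel. f u) = (LINT u|unit_lborel. f u)"
  unfolding set_lebesgue_integral_def by (subst integral_restrict_space) auto

lemma space_unit_lborel [simp]: "space unit_lborel = {0<..<1}"
  by (simp add: space_restrict_space)

lemma sets_unit_lborel [simp, measurable_cong]: "sets unit_lborel = sets unit_borel"
  by (simp add: sets_restrict_space)

lemma measurable_unit_lborel [simp]:
  "borel_measurable unit_lborel = borel_measurable unit_borel"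
  by (intro measurable_cong_sets) auto

interpretation unit_lborel: finite_measure unit_lborel
  by standard (simp add: emeasure_restrict_space)

lemma integrable_unit_indicator:
  assumes "A \<in> sets unit_borel"
  shows "integrable unit_lborel (indicator A :: real \<Rightarrow> real)"
proof (rule integrable_real_indicator)
  show "emeasure unit_lborel A < \<infinity>"
    using unit_lborel.emeasure_finite[of A] by (simp only: top.not_eq_extremum infinity_ennreal_def)
qed (use assms in simp)

lemma incr_rc_ident: "incr_rc (\<lambda>u. u)"
  by (auto simp: incr_rc_def mono_on_def)

lemma stieltjes_rc_ident: "stieltjes_measure_rc (\<lambda>u. u) = unit_lborel"
proof (rule stieltjes_rc_eqI[OF incr_rc_ident, symmetric])
  fix a b :: real assume "0 < a" "a \<le> b" "b < 1"
  then show "emeasure unit_lborel {a<..b} = ennreal (b - a)"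
    by (subst emeasure_restrict_space) auto
qed (simp add: sets_restrict_space)

lemma integrable_indicator_times:
  fixes f :: "'a \<Rightarrow> real"
  assumes "integrable M f" "A \<inter> space M \<in> sets M"
  shows "integrable M (\<lambda>u. indicator A u * f u)"
proof -
  have "integrable M (\<lambda>u. indicator (A \<inter> space M) u *\<^sub>R f u)"
    by (rule integrable_mult_indicator[OF assms(2,1)])
  then show ?thesis
    by (rule Bochner_Integration.integrable_cong[THEN iffD1, rotated 2]) (auto simp: indicator_def)
qed

text \<open>With \<open>lip_dn\<close>, a substitute for the Jordan decomposition of K. It is not
  minimal in general, but monotonicity of the parts is exactly the Lipschitz bound, and their
  measures add up to L times Lebesgue measure instead of merely being dominated by it.\<close>

definition lip_up :: "real \<Rightarrow> (real \<Rightarrow> real) \<Rightarrow> real \<Rightarrow> real" where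
  "lip_up L K u = (L * u + K u) / 2"

definition lip_dn :: "real \<Rightarrow> (real \<Rightarrow> real) \<Rightarrow> real \<Rightarrow> real" where
  "lip_dn L K u = (L * u - K u) / 2"

lemma lip_up_dn: "K u = lip_up L K u - lip_dn L K u" "lip_up L K u + lip_dn L K u = L * u"
  by (simp_all add: lip_up_def lip_dn_def field_simps)

lemma lip_incr_rc:
  assumes K: "L-lipschitz_on {0<..<1} K"
  shows "incr_rc (lip_up L K)" "incr_rc (lip_dn L K)"
proof -
  have *: "\<bar>K v - K u\<bar> \<le> L * (v - u)" if "u \<in> {0<..<1}" "v \<in> {0<..<1}" "u \<le> v" for u v
    using lipschitz_onD[OF K, of v u] that by (simp add: dist_real_def)
  have c: "continuous (at_right u) K" if "u \<in> {0<..<1}" for u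
  proof -
    have "isCont K u"
      using lipschitz_on_continuous_on[OF K] that by (simp add: continuous_on_eq_continuous_at)
    then show ?thesis by (rule continuous_at_imp_continuous_at_within)
  qed
  show "incr_rc (lip_up L K)" unfolding incr_rc_def
  proof (intro conjI ballI mono_onI)
    fix u v :: real assume "u \<in> {0<..<1}" "v \<in> {0<..<1}" "u \<le> v"
    from *[OF this] show "lip_up L K u \<le> lip_up L K v"
      by (simp add: lip_up_def right_diff_distrib abs_le_iff)
  qed (simp add: lip_up_def[abs_def] c continuous_intros)
  show "incr_rc (lip_dn L K)" unfolding incr_rc_def
  proof (intro conjI ballI mono_onI)
    fix u v :: real assume "u \<in> {0<..<1}" "v \<in> {0<..<1}" "u \<le> v"
    from *[OF this] show "lip_dn L K u \<le> lip_dn L K v"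
      by (simp add: lip_dn_def right_diff_distrib abs_le_iff)
  qed (simp add: lip_dn_def[abs_def] c continuous_intros)
qed

lemma lip_integrable:
  assumes K: "L-lipschitz_on {0<..<1} K" and f: "integrable unit_lborel f"
  shows "integrable (stieltjes_measure_rc (lip_up L K)) f" "integrable (stieltjes_measure_rc (lip_dn L K)) f"
    "(LINT u|stieltjes_measure_rc (lip_up L K). f u) + (LINT u|stieltjes_measure_rc (lip_dn L K). f u) =
      L * (LINT u|unit_lborel. f u)"
proof -
  have L: "0 \<le> L" using K by (rule lipschitz_on_nonneg)
  have i: "integrable (stieltjes_measure_rc (\<lambda>u. L * u)) f"
    "(LINT u|stieltjes_measure_rc (\<lambda>u. L * u). f u) = L * (LINT u|unit_lborel. f u)"
    using integral_stieltjes_rc_cmult[OF incr_rc_ident L, of f] f by (simp_all add: stieltjes_rc_ident)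
  have eq: "(\<lambda>u. L * u) = (\<lambda>u. lip_up L K u + lip_dn L K u)"
    by (simp add: lip_up_dn)
  show 1: "integrable (stieltjes_measure_rc (lip_up L K)) f" "integrable (stieltjes_measure_rc (lip_dn L K)) f"
    using i(1) integrable_stieltjes_rc_add[OF lip_incr_rc[OF K]] unfolding eq by auto
  show "(LINT u|stieltjes_measure_rc (lip_up L K). f u) + (LINT u|stieltjes_measure_rc (lip_dn L K). f u) =
      L * (LINT u|unit_lborel. f u)"
    using i(2) integral_stieltjes_rc_add[OF lip_incr_rc[OF K] 1] unfolding eq by simp
qed

lemma has_LS_integral_lipschitz:
  assumes K: "L-lipschitz_on {0<..<1} K" and f: "integrable unit_lborel f" and A: "A \<inter> {0<..<1} \<in> sets unit_borel"
  shows "has_LS_integral f K A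
    ((LINT u|stieltjes_measure_rc (lip_up L K). indicator A u * f u) -
     (LINT u|stieltjes_measure_rc (lip_dn L K). indicator A u * f u))"
  unfolding has_LS_integral_indicator[of f] has_LS_integral_unit_iff
  using lip_integrable[OF K integrable_indicator_times[OF f, of A]] A lip_incr_rc[OF K] lip_up_dn(1)
  by (intro exI[of _ "lip_up L K"] exI[of _ "lip_dn L K"]) auto

lemma LS_integral_lipschitz:
  assumes K: "L-lipschitz_on {0<..<1} K" and f: "integrable unit_lborel f" and A: "A \<inter> {0<..<1} \<in> sets unit_borel"
  shows "LS_integral f K A =
    (LINT u|stieltjes_measure_rc (lip_up L K). indicator A u * f u) -
    (LINT u|stieltjes_measure_rc (lip_dn L K). indicator A u * f u)"
  by (intro LS_integral_eq has_LS_integral_lipschitz assms)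

lemma LS_integrable_lipschitz:
  assumes "L-lipschitz_on {0<..<1} K" "integrable unit_lborel f" "A \<inter> {0<..<1} \<in> sets unit_borel"
  shows "LS_integrable f K A"
  using has_LS_integral_lipschitz[OF assms] unfolding LS_integrable_def by blast

text \<open>Estimating each part by the integral of |f| leaves |f| integrated against the sum of the
  two measures, which is L times Lebesgue measure. The bound involves neither A nor K beyond its
  constant L, hence it is uniform over (s, t) and over K.\<close>

lemma LS_integral_lipschitz_bound:
  assumes K: "L-lipschitz_on {0<..<1} K" and f: "integrable unit_lborel f" and A: "A \<inter> {0<..<1} \<in> sets unit_borel"
  shows "\<bar>LS_integral f K A\<bar> \<le> L * (LINT u|unit_lborel. \<bar>f u\<bar>)"
proof -
  let ?G = "stieltjes_measure_rc (lip_up L K)" and ?H = "stieltjes_measure_rc (lip_dn L K)"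
  have "integrable unit_lborel (\<lambda>u. \<bar>f u\<bar>)" using f by simp
  note I = lip_integrable[OF K this]
  note J = lip_integrable[OF K integrable_indicator_times[OF f, of A]]
  have "\<bar>LINT u|?G. indicator A u * f u\<bar> \<le> (LINT u|?G. \<bar>f u\<bar>)"
    using A J I by (intro integral_abs_bound[THEN order_trans] integral_mono)
      (auto split: split_indicator intro!: integrable_abs)
  moreover have "\<bar>LINT u|?H. indicator A u * f u\<bar> \<le> (LINT u|?H. \<bar>f u\<bar>)"
    using A J I by (intro integral_abs_bound[THEN order_trans] integral_mono)
      (auto split: split_indicator intro!: integrable_abs)
  ultimately show ?thesis
    using I(3) LS_integral_lipschitz[OF assms] by linarith
qed

lemma LS_integral_lipschitz_linear:
  assumes K: "L-lipschitz_on {0<..<1} K" and f: "integrable unit_lborel f" and g: "integrable unit_lborel g"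
    and A: "A \<inter> {0<..<1} \<in> sets unit_borel"
  shows "LS_integral (\<lambda>u. a * f u + b * g u) K A = a * LS_integral f K A + b * LS_integral g K A"
proof -
  have fg: "integrable unit_lborel (\<lambda>u. a * f u + b * g u)"
    using f g by auto
  have *: "(LINT u|M. indicator A u * (a * f u + b * g u)) =
      a * (LINT u|M. indicator A u * f u) + b * (LINT u|M. indicator A u * g u)"
    if "integrable M (\<lambda>u. indicator A u * f u)" "integrable M (\<lambda>u. indicator A u * g u)" for M
    using that by (simp add: distrib_left mult.left_commute[of "indicator A _"])
  show ?thesis
    using A lip_integrable[OF K integrable_indicator_times[OF f, of A]]
      lip_integrable[OF K integrable_indicator_times[OF g, of A]]
    by (simp add: LS_integral_lipschitz[OF K _ A] f g fg * algebra_simps)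
qed

section \<open>Integrals against uniformly small Lipschitz functions\<close>

lemma LS_integral_indicator_set: "LS_integral f K A = LS_integral (\<lambda>u. indicator A u * f u) K {0<..<1}"
proof -
  have "has_LS_integral f K A = has_LS_integral (\<lambda>u. indicator A u * f u) K {0<..<1}"
    by (rule ext) (rule has_LS_integral_indicator)
  then show ?thesis by (simp add: LS_integral_def)
qed

lemma LS_integral_indicator_Ioc:
  assumes K: "L-lipschitz_on {0<..<1} K" and ab: "0 < a" "a \<le> b" "b < 1"
  shows "LS_integral (indicator {a<..b}) K {0<..<1} = K b - K a"
proof -
  have i: "integrable unit_lborel (indicator {a<..b} :: real \<Rightarrow> real)"
    using ab by (intro integrable_unit_indicator) auto
  have *: "(LINT u|stieltjes_measure_rc G. indicator {0<..<1} u * indicator {a<..b} u :: real) = G b - G a"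
    if "incr_rc G" for G
  proof -
    have "(LINT u|stieltjes_measure_rc G. indicator {0<..<1} u * indicator {a<..b} u :: real) =
      (LINT u|stieltjes_measure_rc G. indicator {a<..b} u :: real)"
      by (intro Bochner_Integration.integral_cong) auto
    also have "\<dots> = measure (stieltjes_measure_rc G) {a<..b}"
    proof -
      have "{a<..b} \<inter> {0<..<1} = {a<..b}" using ab by auto
      then show ?thesis by simp
    qed
    also have "\<dots> = G b - G a"
      using ab incr_rc_le[OF that ab] by (simp add: measure_def emeasure_stieltjes_rc[OF that])
    finally show ?thesis .
  qed
  show ?thesis
    using LS_integral_lipschitz[OF K i, of "{0<..<1}"] sets.top[of unit_borel]
    by (simp add: * lip_incr_rc[OF K] space_restrict_space) (simp add: lip_up_def lip_dn_def field_simps)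
qed

text \<open>One family of domains for both maps: the half-open intervals serve
  \<open>lam_tilde\<close>, and the whole interval, which is not among them, serves
  \<open>lam\<close>.\<close>

definition sub_intervals :: "real set set" where
  "sub_intervals = insert {0<..<1} ((\<lambda>(s, t). {s<..t}) ` unit_pairs)"

lemma sub_intervals_sets: "A \<in> sub_intervals \<Longrightarrow> A \<inter> {0<..<1} \<in> sets unit_borel"
proof -
  assume "A \<in> sub_intervals"
  then have "A \<in> sets borel" unfolding sub_intervals_def by auto
  then show ?thesis by (subst Int_commute) (simp only: sets_restrict_space image_eqI)
qed

text \<open>Continuity at 0, in the supremum norm, of the integral of f as a function of the
  integrator, restricted to L-Lipschitz functions. The order of quantifiers matters: \<delta> is
  chosen before K and A.\<close>

definition vanishing_integrals :: "real \<Rightarrow> (real \<Rightarrow> real) \<Rightarrow> bool" where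
  "vanishing_integrals L f \<longleftrightarrow> (\<forall>\<epsilon>>0. \<exists>\<delta>>0. \<forall>K. L-lipschitz_on {0<..<1} K \<longrightarrow>
     (\<forall>u\<in>{0<..<1}. \<bar>K u\<bar> \<le> \<delta>) \<longrightarrow> (\<forall>A\<in>sub_intervals. \<bar>LS_integral f K A\<bar> \<le> \<epsilon>))"

lemma vanishing_integralsI:
  assumes "\<And>\<epsilon>. \<epsilon> > 0 \<Longrightarrow> \<exists>\<delta>>0. \<forall>K. L-lipschitz_on {0<..<1} K \<longrightarrow>
     (\<forall>u\<in>{0<..<1}. \<bar>K u\<bar> \<le> \<delta>) \<longrightarrow> (\<forall>A\<in>sub_intervals. \<bar>LS_integral f K A\<bar> \<le> \<epsilon>)"
  shows "vanishing_integrals L f"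
  unfolding vanishing_integrals_def by (intro allI impI assms)

lemma vanishing_integralsE:
  assumes "vanishing_integrals L f" "\<epsilon> > 0"
  obtains \<delta> where "\<delta> > 0" "\<And>(K :: real \<Rightarrow> real) A. L-lipschitz_on {0<..<1} K \<Longrightarrow> (\<And>u. u\<in>{0<..<1} \<Longrightarrow> \<bar>K u\<bar> \<le> \<delta>) \<Longrightarrow>
     A \<in> sub_intervals \<Longrightarrow> \<bar>LS_integral f K A\<bar> \<le> \<epsilon>"
proof -
  obtain \<delta> where "\<delta> > 0" and *: "\<forall>K. L-lipschitz_on {0<..<1} K \<longrightarrow>
     (\<forall>u\<in>{0<..<1}. \<bar>K u\<bar> \<le> \<delta>) \<longrightarrow> (\<forall>A\<in>sub_intervals. \<bar>LS_integral f K A\<bar> \<le> \<epsilon>)"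
    using assms(1)[unfolded vanishing_integrals_def, THEN spec, THEN mp, OF assms(2)] by blast
  show thesis
  proof (rule that[OF \<open>\<delta> > 0\<close>])
    fix K :: "real \<Rightarrow> real" and A assume "L-lipschitz_on {0<..<1} K" "\<And>u. u\<in>{0<..<1} \<Longrightarrow> \<bar>K u\<bar> \<le> \<delta>" "A \<in> sub_intervals"
    then show "\<bar>LS_integral f K A\<bar> \<le> \<epsilon>" by (intro *[rule_format])
  qed
qed

text \<open>Replacing f by g costs at most L times their L^1 distance, whatever K and A are, so the
  property is closed under L^1 limits. The denominator uses L + 1 to allow L = 0.\<close>

lemma vanishing_integrals_approx:
  assumes L: "0 \<le> L" and f: "integrable unit_lborel f"
    and g: "\<And>\<epsilon>. \<epsilon> > 0 \<Longrightarrow> \<exists>g. integrable unit_lborel g \<and> vanishing_integrals L g \<and>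
      (LINT u|unit_lborel. \<bar>f u - g u\<bar>) \<le> \<epsilon>"
  shows "vanishing_integrals L f"
proof (rule vanishing_integralsI)
  fix \<epsilon> :: real assume \<epsilon>: "\<epsilon> > 0"
  obtain g where g: "integrable unit_lborel g" "vanishing_integrals L g"
    "(LINT u|unit_lborel. \<bar>f u - g u\<bar>) \<le> \<epsilon> / (2 * (L + 1))"
    using g[of "\<epsilon> / (2 * (L + 1))"] \<epsilon> L by auto
  obtain \<delta> where \<delta>: "\<delta> > 0" "\<And>(K :: real \<Rightarrow> real) A. L-lipschitz_on {0<..<1} K \<Longrightarrow> (\<And>u. u\<in>{0<..<1} \<Longrightarrow> \<bar>K u\<bar> \<le> \<delta>) \<Longrightarrow>
     A \<in> sub_intervals \<Longrightarrow> \<bar>LS_integral g K A\<bar> \<le> \<epsilon> / 2"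
    by (rule vanishing_integralsE[OF g(2), of "\<epsilon> / 2"]) (use \<epsilon> in auto)
  show "\<exists>\<delta>>0. \<forall>K. L-lipschitz_on {0<..<1} K \<longrightarrow>
     (\<forall>u\<in>{0<..<1}. \<bar>K u\<bar> \<le> \<delta>) \<longrightarrow> (\<forall>A\<in>sub_intervals. \<bar>LS_integral f K A\<bar> \<le> \<epsilon>)"
  proof (intro exI[of _ \<delta>] conjI allI impI ballI)
    fix K :: "real \<Rightarrow> real" and A :: "real set"
    assume K: "L-lipschitz_on {0<..<1} K" "\<forall>u\<in>{0<..<1}. \<bar>K u\<bar> \<le> \<delta>" and A: "A \<in> sub_intervals"
    have d: "integrable unit_lborel (\<lambda>u. f u - g u)" using f g by auto
    note A' = sub_intervals_sets[OF A]
    have "\<bar>LS_integral (\<lambda>u. f u - g u) K A\<bar> \<le> L * (\<epsilon> / (2 * (L + 1)))"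
      using LS_integral_lipschitz_bound[OF K(1) d A'] mult_left_mono[OF g(3) L] by simp
    also have "\<dots> \<le> \<epsilon> / 2" using L \<epsilon> by (simp add: field_simps)
    finally have "\<bar>LS_integral (\<lambda>u. f u - g u) K A\<bar> \<le> \<epsilon> / 2" .
    moreover have "\<bar>LS_integral g K A\<bar> \<le> \<epsilon> / 2" using K A by (intro \<delta>) auto
    moreover have "LS_integral f K A = LS_integral g K A + LS_integral (\<lambda>u. f u - g u) K A"
      using LS_integral_lipschitz_linear[OF K(1) g(1) d A', of 1 1] by simp
    ultimately show "\<bar>LS_integral f K A\<bar> \<le> \<epsilon>" by linarith
  qed fact
qed

text \<open>Dominated convergence turns a dominated pointwise limit into an L^1 limit, which is the
  form of closure needed in the inductions over sets and functions.\<close>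

lemma vanishing_integrals_lim:
  assumes L: "0 \<le> L" and s: "\<And>i::nat. integrable unit_lborel (s i)" "\<And>i. vanishing_integrals L (s i)"
    and lim: "\<And>u. u \<in> {0<..<1} \<Longrightarrow> (\<lambda>i. s i u) \<longlonglongrightarrow> f u"
    and w: "integrable unit_lborel w" "\<And>i u. u \<in> {0<..<1} \<Longrightarrow> \<bar>s i u\<bar> \<le> w u"
    and f: "integrable unit_lborel f"
  shows "vanishing_integrals L f"
proof (rule vanishing_integrals_approx[OF L f])
  fix \<epsilon> :: real assume \<epsilon>: "\<epsilon> > 0"
  have "(\<lambda>i. LINT u|unit_lborel. \<bar>f u - s i u\<bar>) \<longlonglongrightarrow> (LINT u|unit_lborel. 0)"
  proof (rule integral_dominated_convergence[where w="\<lambda>u. \<bar>f u\<bar> + w u"])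
    show "integrable unit_lborel (\<lambda>u. \<bar>f u\<bar> + w u)" using w f by auto
    show "AE u in unit_lborel. (\<lambda>i. \<bar>f u - s i u\<bar>) \<longlonglongrightarrow> 0"
    proof (rule AE_I2)
      fix u assume "u \<in> space unit_lborel"
      then have "(\<lambda>i. f u - s i u) \<longlonglongrightarrow> f u - f u"
        by (intro tendsto_intros lim) simp
      then show "(\<lambda>i. \<bar>f u - s i u\<bar>) \<longlonglongrightarrow> 0"
        by (intro tendsto_rabs_zero) simp
    qed
    show "AE u in unit_lborel. norm \<bar>f u - s i u\<bar> \<le> \<bar>f u\<bar> + w u" for i
    proof (rule AE_I2)
      fix u assume "u \<in> space unit_lborel"
      then have "\<bar>s i u\<bar> \<le> w u" by (simp add: w)
      then show "norm \<bar>f u - s i u\<bar> \<le> \<bar>f u\<bar> + w u" by simp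
    qed
    show "(\<lambda>u. \<bar>f u - s i u\<bar>) \<in> borel_measurable unit_lborel" for i
      using f s(1)[of i] by (intro borel_measurable_abs borel_measurable_diff borel_measurable_integrable)
  qed simp
  then have "eventually (\<lambda>i. (LINT u|unit_lborel. \<bar>f u - s i u\<bar>) < \<epsilon>) sequentially"
    using \<epsilon> by (intro order_tendstoD) auto
  then obtain i where "(LINT u|unit_lborel. \<bar>f u - s i u\<bar>) < \<epsilon>"
    by (auto simp: eventually_sequentially)
  then show "\<exists>g. integrable unit_lborel g \<and> vanishing_integrals L g \<and>
      (LINT u|unit_lborel. \<bar>f u - g u\<bar>) \<le> \<epsilon>"
    using s by (intro exI[of _ "s i"]) auto
qed

lemma vanishing_integrals_linear:
  assumes f: "integrable unit_lborel f" "vanishing_integrals L f"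
    and g: "integrable unit_lborel g" "vanishing_integrals L g"
  shows "vanishing_integrals L (\<lambda>u. a * f u + b * g u)"
proof (rule vanishing_integralsI)
  fix \<epsilon> :: real assume \<epsilon>: "\<epsilon> > 0"
  \<comment> \<open>The added 1 keeps c positive when both coefficients vanish.\<close>
  define c where "c = \<bar>a\<bar> + \<bar>b\<bar> + 1"
  have c: "c > 0" by (simp add: c_def)
  obtain \<delta> where \<delta>: "\<delta> > 0" "\<And>(K :: real \<Rightarrow> real) A. L-lipschitz_on {0<..<1} K \<Longrightarrow> (\<And>u. u\<in>{0<..<1} \<Longrightarrow> \<bar>K u\<bar> \<le> \<delta>) \<Longrightarrow>
     A \<in> sub_intervals \<Longrightarrow> \<bar>LS_integral f K A\<bar> \<le> \<epsilon> / c"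
    by (rule vanishing_integralsE[OF f(2), of "\<epsilon> / c"]) (use \<epsilon> c in auto)
  obtain \<eta> where \<eta>: "\<eta> > 0" "\<And>(K :: real \<Rightarrow> real) A. L-lipschitz_on {0<..<1} K \<Longrightarrow> (\<And>u. u\<in>{0<..<1} \<Longrightarrow> \<bar>K u\<bar> \<le> \<eta>) \<Longrightarrow>
     A \<in> sub_intervals \<Longrightarrow> \<bar>LS_integral g K A\<bar> \<le> \<epsilon> / c"
    by (rule vanishing_integralsE[OF g(2), of "\<epsilon> / c"]) (use \<epsilon> c in auto)
  show "\<exists>\<delta>>0. \<forall>K. L-lipschitz_on {0<..<1} K \<longrightarrow>
     (\<forall>u\<in>{0<..<1}. \<bar>K u\<bar> \<le> \<delta>) \<longrightarrow> (\<forall>A\<in>sub_intervals. \<bar>LS_integral (\<lambda>u. a * f u + b * g u) K A\<bar> \<le> \<epsilon>)"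
  proof (intro exI[of _ "min \<delta> \<eta>"] conjI allI impI ballI)
    fix K :: "real \<Rightarrow> real" and A :: "real set"
    assume K: "L-lipschitz_on {0<..<1} K" "\<forall>u\<in>{0<..<1}. \<bar>K u\<bar> \<le> min \<delta> \<eta>" and A: "A \<in> sub_intervals"
    have "\<bar>LS_integral f K A\<bar> \<le> \<epsilon> / c" "\<bar>LS_integral g K A\<bar> \<le> \<epsilon> / c"
      using K A by (auto intro!: \<delta> \<eta>)
    then have "\<bar>a * LS_integral f K A\<bar> + \<bar>b * LS_integral g K A\<bar> \<le> \<bar>a\<bar> * (\<epsilon> / c) + \<bar>b\<bar> * (\<epsilon> / c)"
      unfolding abs_mult by (intro add_mono mult_left_mono) auto
    also have "\<dots> = (\<bar>a\<bar> + \<bar>b\<bar>) * \<epsilon> / c" by (simp add: distrib_right add_divide_distrib)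
    also have "\<dots> \<le> \<epsilon>" using c \<epsilon> by (simp add: field_simps c_def)
    finally show "\<bar>LS_integral (\<lambda>u. a * f u + b * g u) K A\<bar> \<le> \<epsilon>"
      unfolding LS_integral_lipschitz_linear[OF K(1) f(1) g(1) sub_intervals_sets[OF A]] by linarith
  qed (use \<delta> \<eta> in auto)
qed

text \<open>A meets the interval in another half-open interval \<open>{c<..d}\<close>, so the
  integral is \<open>K d - K c\<close>, at most twice the supremum of |K|; therefore \<delta> =
  \<epsilon> / 2 works, for every L.\<close>

lemma vanishing_integrals_Ioc:
  assumes ab: "0 < a" "a \<le> b" "b < 1"
  shows "vanishing_integrals L (indicator {a<..b})"
proof (rule vanishing_integralsI)
  fix \<epsilon> :: real assume \<epsilon>: "\<epsilon> > 0"
  show "\<exists>\<delta>>0. \<forall>K. L-lipschitz_on {0<..<1} K \<longrightarrow>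
     (\<forall>u\<in>{0<..<1}. \<bar>K u\<bar> \<le> \<delta>) \<longrightarrow> (\<forall>A\<in>sub_intervals. \<bar>LS_integral (indicator {a<..b}) K A\<bar> \<le> \<epsilon>)"
  proof (intro exI[of _ "\<epsilon> / 2"] conjI allI impI ballI)
    fix K :: "real \<Rightarrow> real" and A :: "real set"
    assume K: "L-lipschitz_on {0<..<1} K" "\<forall>u\<in>{0<..<1}. \<bar>K u\<bar> \<le> \<epsilon> / 2" and A: "A \<in> sub_intervals"
    obtain c d where cd: "0 < c" "c \<le> d" "d < 1" "A \<inter> {a<..b} = {c<..d}"
    proof (cases "A = {0<..<1}")
      case True
      then show thesis using ab by (intro that[of a b]) auto
    next
      case False
      then obtain s t where st: "0 < s" "s \<le> t" "t < 1" "A = {s<..t}"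
        using A by (auto simp: sub_intervals_def)
      show thesis
        using st ab by (intro that[of "max a s" "max (max a s) (min b t)"]) auto
    qed
    have "(\<lambda>u. indicator A u * indicator {a<..b} u :: real) = indicator {c<..d}"
      unfolding cd(4)[symmetric] by (simp add: indicator_inter_arith fun_eq_iff)
    then have "LS_integral (indicator {a<..b}) K A = K d - K c"
      by (subst LS_integral_indicator_set) (simp add: LS_integral_indicator_Ioc[OF K(1) cd(1-3)])
    moreover have "\<bar>K d\<bar> \<le> \<epsilon> / 2" "\<bar>K c\<bar> \<le> \<epsilon> / 2" using K(2) cd by auto
    ultimately show "\<bar>LS_integral (indicator {a<..b}) K A\<bar> \<le> \<epsilon>" by linarith
  qed (use \<epsilon> in auto)
qed

text \<open>Complements in the next induction are taken within the whole interval, which is not one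
  of the half-open generators. It is reached as the dominated limit of the exhausting
  intervals.\<close>

lemma vanishing_integrals_unit:
  assumes L: "0 \<le> L"
  shows "vanishing_integrals L (indicator {0<..<1})"
proof (rule vanishing_integrals_lim[OF L, where w = "\<lambda>_. 1"])
  fix u :: real assume u: "u \<in> {0<..<1}"
  obtain n where n: "cutoff n < min u (1 - u)" using cutoff_less[of "min u (1 - u)"] u by auto
  have "cutoff i \<le> cutoff n" if "n \<le> i" for i
    unfolding cutoff_def using that by (intro divide_left_mono) auto
  then have "\<forall>i\<ge>n. indicator {cutoff i<..1 - cutoff i} u = (1::real)"
    using n by (force simp: indicator_def)
  then show "(\<lambda>i. indicator {cutoff i<..1 - cutoff i} u :: real) \<longlonglongrightarrow> indicator {0<..<1} u"
    using u by (intro tendsto_eventually) (auto simp: eventually_sequentially)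
next
  show "vanishing_integrals L (indicator {cutoff i<..1 - cutoff i})" for i
    using cutoff_pairs[of i] by (intro vanishing_integrals_Ioc) auto
next
  show "integrable unit_lborel (indicator {cutoff i<..1 - cutoff i} :: real \<Rightarrow> real)" for i
    using cutoff_pairs[of i] by (intro integrable_unit_indicator Ioc_in_sets_unit less_imp_le[OF cutoff_pos]) auto
  show "integrable unit_lborel (indicator {0<..<1} :: real \<Rightarrow> real)"
    using sets.top[of unit_borel] by (intro integrable_unit_indicator) (simp add: space_restrict_space)
qed (auto simp: indicator_le_1)

text \<open>A Dynkin system argument from the intersection-stable half-open intervals: linearity
  handles complements and finite disjoint unions, and dominated convergence the countable ones. The
  empty set enters as \<open>{1/2<..1/2}\<close>.\<close>

lemma vanishing_integrals_indicator:
  assumes L: "0 \<le> L" and A: "A \<in> sets unit_borel"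
  shows "vanishing_integrals L (indicator A)"
proof -
  let ?G = "(\<lambda>(a, b). {a<..b}) ` unit_pairs"
  have sub: "?G \<subseteq> Pow {0<..<1}" by auto
  have "A \<in> sigma_sets {0<..<1} ?G" using A by (simp only: sigma_sets_unit_Ioc)
  with Int_stable_unit_Ioc sub show ?thesis
  proof (induction rule: sigma_sets_induct_disjoint)
    case (basic B)
    then show ?case by (auto intro: vanishing_integrals_Ioc)
  next
    case empty
    have "vanishing_integrals L (indicator {1/2<..1/2})"
      by (intro vanishing_integrals_Ioc) auto
    then show ?case by (simp only: greaterThanAtMost_empty[OF order_refl])
  next
    case (compl B)
    then have B: "B \<in> sets unit_borel" by (simp only: sigma_sets_unit_Ioc)
    then have "B \<subseteq> {0<..<1}" by (auto simp: sets_restrict_space)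
    then have "indicator ({0<..<1} - B) = (\<lambda>u. 1 * indicator {0<..<1} u + (-1) * indicator B u :: real)"
      by (auto simp: indicator_def fun_eq_iff)
    moreover have "vanishing_integrals L (\<lambda>u. 1 * indicator {0<..<1} u + (-1) * indicator B u)"
      using sets.top[of unit_borel] B compl
      by (intro vanishing_integrals_linear vanishing_integrals_unit integrable_unit_indicator L)
        (auto simp: space_restrict_space)
    ultimately show ?case by simp
  next
    case (union B)
    then have B: "\<And>i. B i \<in> sets unit_borel" by (auto simp only: sigma_sets_unit_Ioc)
    have fin: "vanishing_integrals L (indicator (\<Union>i<n. B i))" for n :: nat
    proof (induction n)
      case 0
      have "(indicator (\<Union>i<0. B i) :: real \<Rightarrow> real) = indicator {1/2<..1/2}"
        by (simp add: fun_eq_iff)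
      moreover have "vanishing_integrals L (indicator {1/2<..1/2})"
        by (intro vanishing_integrals_Ioc) auto
      ultimately show ?case by (simp only:)
    next
      case (Suc n)
      have "(\<Union>i<n. B i) \<inter> B n = {}"
        using union(1) by (auto simp: disjoint_family_on_def lessThan_iff) (metis disjoint_iff less_irrefl)
      then have "indicator (\<Union>i<Suc n. B i) = (\<lambda>u. 1 * indicator (\<Union>i<n. B i) u + 1 * indicator (B n) u :: real)"
        by (auto simp: indicator_def fun_eq_iff lessThan_Suc)
      then show ?case
        using B Suc union(3) vanishing_integrals_linear[of "indicator (\<Union>i<n. B i)" L "indicator (B n)" 1 1]
        by (simp add: integrable_unit_indicator sets.finite_UN)
    qed
    show ?case
    proof (rule vanishing_integrals_lim[OF L, where w = "\<lambda>_. 1" and s = "\<lambda>n. indicator (\<Union>i<n. B i)"])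
      show "(\<lambda>n. indicator (\<Union>i<n. B i) u :: real) \<longlonglongrightarrow> indicator (\<Union>i. B i) u" for u
        by (rule LIMSEQ_indicator_UN)
      show "integrable unit_lborel (indicator (\<Union>i<n. B i) :: real \<Rightarrow> real)" for n
        using B by (intro integrable_unit_indicator) auto
      show "integrable unit_lborel (indicator (\<Union>i. B i) :: real \<Rightarrow> real)"
        using B by (intro integrable_unit_indicator) auto
    qed (auto simp: indicator_le_1 fin)
  qed
qed

text \<open>The induction rule for integrable functions approximates f pointwise by functions
  bounded by 2|f|, whence the majorant. The result is applied to the limit direction z.\<close>

lemma vanishing_integrals_integrable:
  assumes L: "0 \<le> L" and f: "integrable unit_lborel f"
  shows "vanishing_integrals L f"
  using f
proof induction
  case (base A c)
  then have A: "A \<in> sets unit_borel" by simp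
  have "vanishing_integrals L (\<lambda>u. c * indicator A u + 0 * indicator A u)"
    using A by (intro vanishing_integrals_linear vanishing_integrals_indicator L integrable_unit_indicator)
  then show ?case by (simp add: mult.commute)
next
  case (add f g)
  then show ?case using vanishing_integrals_linear[of f L g 1 1] by simp
next
  case (lim f s)
  show ?case
    by (rule vanishing_integrals_lim[OF L, where s = s and w = "\<lambda>u. 2 * \<bar>f u\<bar>"]) (use lim in auto)
qed

section \<open>Integration by parts\<close>

lemma mono_on_measurable_unit:
  "mono_on {0<..<1} F \<Longrightarrow> F \<in> borel_measurable unit_borel" for F :: "real \<Rightarrow> real"
  by (rule borel_measurable_mono_on_fnc)

lemma measurable_unit_borel_times:
  fixes f :: "real \<Rightarrow> real"
  assumes "f \<in> borel_measurable unit_borel" "A \<inter> {0<..<1} \<in> sets unit_borel"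
  shows "(\<lambda>u. indicator A u * f u) \<in> borel_measurable unit_borel"
proof -
  have "(\<lambda>u. indicator (A \<inter> {0<..<1}) u * f u) \<in> borel_measurable unit_borel"
    using assms by (intro borel_measurable_times borel_measurable_indicator)
  then show ?thesis
    by (rule measurable_cong[THEN iffD1, rotated]) (auto simp: indicator_def space_restrict_space)
qed

text \<open>Fubini's theorem on \<open>{(u, v). s \<le> v < u \<le> t}\<close>.\<close>

lemma integration_by_parts_mono:
  assumes Q: "incr_lc Q"
    and G: "incr_rc G" and st: "0 < s" "s \<le> t" "t < 1"
  shows "integrable (stieltjes_measure_rc G) (\<lambda>u. indicator {s<..t} u * Q u)" (is ?th1)
    and "integrable (stieltjes_measure_lc Q) (\<lambda>u. indicator {s..<t} u * G u)" (is ?th2)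
    and "(LINT u|stieltjes_measure_rc G. indicator {s<..t} u * Q u) =
      Q t * G t - Q s * G s - (LINT u|stieltjes_measure_lc Q. indicator {s..<t} u * G u)" (is ?th3)
proof -
  let ?\<nu> = "stieltjes_measure_rc G" and ?\<mu> = "stieltjes_measure_lc Q"
  have Qle: "Q u \<le> Q v" if "0 < u" "u \<le> v" "v < 1" for u v
    using mono_onD[OF incr_lcD(1)[OF Q]] that by auto
  note Gle = incr_rc_le[OF G]
  have mQ: "Q \<in> borel_measurable unit_borel" and mG: "G \<in> borel_measurable unit_borel"
    using incr_lcD(1)[OF Q] incr_rcD(1)[OF G] by (auto intro: mono_on_measurable_unit)
  have S1: "{s<..t} \<in> sets unit_borel" and S2: "{s..<t} \<in> sets unit_borel"
    using st by auto
  have e1: "emeasure ?\<nu> {s<..t} = ennreal (G t - G s)" and e2: "emeasure ?\<mu> {s..<t} = ennreal (Q t - Q s)"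
    by (rule emeasure_stieltjes_rc[OF G st], rule emeasure_stieltjes_lc[OF Q st])
  have i1: "integrable ?\<nu> (\<lambda>u. indicator {s<..t} u :: real)" and i2: "integrable ?\<mu> (\<lambda>u. indicator {s..<t} u :: real)"
    using S1 S2 e1 e2 by (auto intro!: integrable_real_indicator)
  have m1: "measure ?\<nu> {s<..t} = G t - G s" and m2: "measure ?\<mu> {s..<t} = Q t - Q s"
    using e1 e2 Gle[OF st] Qle[OF st] by (simp_all add: measure_def)
  have sub: "{s<..t} \<inter> {0<..<1} = {s<..t}" "{s..<t} \<inter> {0<..<1} = {s..<t}" using st by auto
  show ?th1
  proof (rule integrableI_bounded_set[where A = "{s<..t}" and B = "\<bar>Q s\<bar> + \<bar>Q t\<bar>"])
    show "AE u in ?\<nu>. u \<in> {s<..t} \<longrightarrow> norm (indicator {s<..t} u * Q u) \<le> \<bar>Q s\<bar> + \<bar>Q t\<bar>"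
    proof (intro AE_I2 impI)
      fix u assume "u \<in> {s<..t}"
      then have "Q s \<le> Q u" "Q u \<le> Q t" using st by (auto intro!: Qle)
      then show "norm (indicator {s<..t} u * Q u) \<le> \<bar>Q s\<bar> + \<bar>Q t\<bar>"
        using \<open>u \<in> {s<..t}\<close> by simp
    qed
  qed (use S1 e1 in \<open>auto intro!: measurable_unit_borel_times mQ simp: sub\<close>)
  show ?th2
  proof (rule integrableI_bounded_set[where A = "{s..<t}" and B = "\<bar>G s\<bar> + \<bar>G t\<bar>"])
    show "AE u in ?\<mu>. u \<in> {s..<t} \<longrightarrow> norm (indicator {s..<t} u * G u) \<le> \<bar>G s\<bar> + \<bar>G t\<bar>"
    proof (intro AE_I2 impI)
      fix u assume "u \<in> {s..<t}"
      then have "G s \<le> G u" "G u \<le> G t" using st by (auto intro!: Gle)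
      then show "norm (indicator {s..<t} u * G u) \<le> \<bar>G s\<bar> + \<bar>G t\<bar>"
        using \<open>u \<in> {s..<t}\<close> by simp
    qed
  qed (use S2 e2 in \<open>auto intro!: measurable_unit_borel_times mG simp: sub\<close>)
  interpret \<nu>: sigma_finite_measure ?\<nu> by (rule sigma_finite_stieltjes_rc[OF G])
  interpret \<mu>: sigma_finite_measure ?\<mu> by (rule sigma_finite_stieltjes_lc[OF Q])
  interpret pair_sigma_finite ?\<nu> ?\<mu> ..
  \<comment> \<open>The strict inequality between the coordinates gives the sections
    \<open>{v<..t}\<close> for dG and \<open>{s..<u}\<close> for dQ. These are the intervals on
    which the two measures are plain increments, so common jumps of Q and G need no correction
    term.\<close>
  define T where "T = {p. s \<le> snd p \<and> snd p < fst p \<and> fst p \<le> t}"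
  have id: "(\<lambda>x. x) \<in> measurable unit_borel borel"
    by (intro measurable_restrict_space1) simp
  have f: "(\<lambda>p. fst p) \<in> borel_measurable (?\<nu> \<Otimes>\<^sub>M ?\<mu>)" and g: "(\<lambda>p. snd p) \<in> borel_measurable (?\<nu> \<Otimes>\<^sub>M ?\<mu>)"
    using measurable_compose[OF measurable_fst, of "\<lambda>x. x" ?\<nu> borel ?\<mu>]
      measurable_compose[OF measurable_snd, of "\<lambda>x. x" ?\<mu> borel ?\<nu>] id by simp_all
  have "Measurable.pred (?\<nu> \<Otimes>\<^sub>M ?\<mu>) (\<lambda>p. s \<le> snd p \<and> snd p < fst p \<and> fst p \<le> t)"
    using f g by measurable
  then have ind: "(\<lambda>p. indicator T p :: ennreal) \<in> borel_measurable (?\<nu> \<Otimes>\<^sub>M ?\<mu>)"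
    unfolding T_def by (intro borel_measurable_indicator') (simp add: pred_def)
  \<comment> \<open>This is the version for nonnegative functions, so no integrability on the
    product is required. Both iterated integrals have nonnegative increments as integrands and
    become Bochner integrals afterwards.\<close>
  have "(\<integral>\<^sup>+ v. (\<integral>\<^sup>+ u. indicator T (u, v) \<partial>?\<nu>) \<partial>?\<mu>) = (\<integral>\<^sup>+ u. (\<integral>\<^sup>+ v. indicator T (u, v) \<partial>?\<mu>) \<partial>?\<nu>)"
    by (rule Fubini[OF ind])
  moreover have "(\<integral>\<^sup>+ u. indicator T (u, v) \<partial>?\<nu>) = ennreal (indicator {s..<t} v * (G t - G v))" for v
  proof (cases "v \<in> {s..<t}")
    case True
    have "(\<integral>\<^sup>+ u. indicator T (u, v) \<partial>?\<nu>) = (\<integral>\<^sup>+ u. indicator {v<..t} u \<partial>?\<nu>)"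
      using True by (intro nn_integral_cong) (auto simp: T_def indicator_def)
    also have "\<dots> = emeasure ?\<nu> {v<..t}"
      using st True by (intro nn_integral_indicator) auto
    finally show ?thesis using st True by (simp add: emeasure_stieltjes_rc[OF G])
  next
    case False
    then have "(\<integral>\<^sup>+ u. indicator T (u, v) \<partial>?\<nu>) = (\<integral>\<^sup>+ u. 0 \<partial>?\<nu>)"
      by (intro nn_integral_cong) (auto simp: T_def indicator_def)
    then show ?thesis using False by simp
  qed
  moreover have "(\<integral>\<^sup>+ v. indicator T (u, v) \<partial>?\<mu>) = ennreal (indicator {s<..t} u * (Q u - Q s))" for u
  proof (cases "u \<in> {s<..t}")
    case True
    have "(\<integral>\<^sup>+ v. indicator T (u, v) \<partial>?\<mu>) = (\<integral>\<^sup>+ v. indicator {s..<u} v \<partial>?\<mu>)"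
      using True by (intro nn_integral_cong) (auto simp: T_def indicator_def)
    also have "\<dots> = emeasure ?\<mu> {s..<u}"
      using st True by (intro nn_integral_indicator) auto
    also have "\<dots> = ennreal (Q u - Q s)"
      using st True by (intro emeasure_stieltjes_lc Q) auto
    finally show ?thesis using True by simp
  next
    case False
    then have "(\<integral>\<^sup>+ v. indicator T (u, v) \<partial>?\<mu>) = (\<integral>\<^sup>+ v. 0 \<partial>?\<mu>)"
      by (intro nn_integral_cong) (auto simp: T_def indicator_def)
    then show ?thesis using False by simp
  qed
  ultimately have fub: "(\<integral>\<^sup>+ v. ennreal (indicator {s..<t} v * (G t - G v)) \<partial>?\<mu>) =
      (\<integral>\<^sup>+ u. ennreal (indicator {s<..t} u * (Q u - Q s)) \<partial>?\<nu>)"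
    by simp
  have eqG: "(\<lambda>v. indicator {s..<t} v * (G t - G v)) = (\<lambda>v. G t * indicator {s..<t} v - indicator {s..<t} v * G v)"
    by (simp add: algebra_simps)
  have eqQ: "(\<lambda>u. indicator {s<..t} u * (Q u - Q s)) = (\<lambda>u. indicator {s<..t} u * Q u - Q s * indicator {s<..t} u)"
    by (simp add: algebra_simps)
  have iG: "integrable ?\<mu> (\<lambda>v. indicator {s..<t} v * (G t - G v))"
    unfolding eqG using i2 \<open>?th2\<close> by simp
  have iQ: "integrable ?\<nu> (\<lambda>u. indicator {s<..t} u * (Q u - Q s))"
    unfolding eqQ using i1 \<open>?th1\<close> by simp
  have nG: "0 \<le> indicator {s..<t} v * (G t - G v)" for v
    using Gle[of v t] st by (auto simp: indicator_def)
  have nQ: "0 \<le> indicator {s<..t} u * (Q u - Q s)" for u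
    using Qle[of s u] st by (auto simp: indicator_def)
  have "ennreal (LINT v|?\<mu>. indicator {s..<t} v * (G t - G v)) =
      ennreal (LINT u|?\<nu>. indicator {s<..t} u * (Q u - Q s))"
    using fub nn_integral_eq_integral[OF iG] nn_integral_eq_integral[OF iQ] nG nQ by simp
  then have "(LINT v|?\<mu>. indicator {s..<t} v * (G t - G v)) = (LINT u|?\<nu>. indicator {s<..t} u * (Q u - Q s))"
    by (subst (asm) ennreal_inj) (auto intro!: Bochner_Integration.integral_nonneg nG nQ)
  moreover have "(LINT v|?\<mu>. indicator {s..<t} v * (G t - G v)) =
      G t * (Q t - Q s) - (LINT u|?\<mu>. indicator {s..<t} u * G u)"
    unfolding eqG using i2 \<open>?th2\<close> m2 by (simp add: sub)
  moreover have "(LINT u|?\<nu>. indicator {s<..t} u * (Q u - Q s)) =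
      (LINT u|?\<nu>. indicator {s<..t} u * Q u) - Q s * (G t - G s)"
    unfolding eqQ using i1 \<open>?th1\<close> m1 by (simp add: sub)
  ultimately show ?th3 by (simp add: algebra_simps)
qed

lemma integration_by_parts_diff:
  assumes Q: "incr_lc Q"
    and GH: "incr_rc G" "incr_rc H" "\<forall>u\<in>{0<..<1}. \<kappa> u = G u - H u"
    and st: "0 < s" "s \<le> t" "t < 1"
  shows "(LINT u|stieltjes_measure_rc G. indicator {s<..t} u * Q u) -
      (LINT u|stieltjes_measure_rc H. indicator {s<..t} u * Q u) =
      Q t * \<kappa> t - Q s * \<kappa> s - (LINT u|stieltjes_measure_lc Q. indicator {s..<t} u * \<kappa> u)"
proof -
  note bG = integration_by_parts_mono[OF Q GH(1) st] and bH = integration_by_parts_mono[OF Q GH(2) st]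
  have "(LINT u|stieltjes_measure_lc Q. indicator {s..<t} u * \<kappa> u) =
      (LINT u|stieltjes_measure_lc Q. indicator {s..<t} u * G u - indicator {s..<t} u * H u)"
    using GH(3) by (intro Bochner_Integration.integral_cong) (auto simp: right_diff_distrib)
  also have "\<dots> = (LINT u|stieltjes_measure_lc Q. indicator {s..<t} u * G u) -
      (LINT u|stieltjes_measure_lc Q. indicator {s..<t} u * H u)"
    by (rule Bochner_Integration.integral_diff[OF bG(2) bH(2)])
  finally have j: "(LINT u|stieltjes_measure_lc Q. indicator {s..<t} u * \<kappa> u) =
      (LINT u|stieltjes_measure_lc Q. indicator {s..<t} u * G u) -
      (LINT u|stieltjes_measure_lc Q. indicator {s..<t} u * H u)" .
  have "\<kappa> s = G s - H s" "\<kappa> t = G t - H t" using GH(3) st by auto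
  then show ?thesis
    using bG(3) bH(3) j by (simp add: right_diff_distrib)
qed

text \<open>The right-hand side does not involve the decomposition of \<kappa>. This is what makes
  the two cases in the definition of \<open>int_dir_Ioc\<close> agree.\<close>

lemma has_LS_integral_by_parts:
  assumes Q: "incr_lc Q"
    and I: "has_LS_integral Q \<kappa> {s<..t} I" and st: "0 < s" "s \<le> t" "t < 1"
  shows "I = Q t * \<kappa> t - Q s * \<kappa> s - (LINT u|stieltjes_measure_lc Q. indicator {s..<t} u * \<kappa> u)"
proof -
  obtain G H where GH: "incr_rc G" "incr_rc H" "\<forall>u\<in>{0<..<1}. \<kappa> u = G u - H u"
    "I = (LINT u|stieltjes_measure_rc G. indicator {s<..t} u * Q u) -
         (LINT u|stieltjes_measure_rc H. indicator {s<..t} u * Q u)"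
    by (rule has_LS_integralE[OF I])
  show ?thesis
    unfolding GH(4) by (rule integration_by_parts_diff[OF Q GH(1-3) st])
qed

text \<open>Dominated convergence, with |f| as majorant, for a domain that moves with a continuous
  parameter. First countability reduces the limit to sequences, for which the convergence theorem is
  available.\<close>

lemma tendsto_integral_indicator:
  fixes f :: "'a \<Rightarrow> real" and x :: "'b :: first_countable_topology"
  assumes f: "integrable M f" and A: "\<And>v. A v \<inter> space M \<in> sets M" and B: "B \<inter> space M \<in> sets M"
    and ev: "\<And>u. u \<in> space M \<Longrightarrow> eventually (\<lambda>v. u \<in> A v \<longleftrightarrow> u \<in> B) (at x within S)"
  shows "((\<lambda>v. LINT u|M. indicator (A v) u * f u) \<longlongrightarrow> (LINT u|M. indicator B u * f u)) (at x within S)"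
  unfolding tendsto_at_iff_sequentially
proof (intro allI impI)
  fix X :: "nat \<Rightarrow> 'b" assume X: "\<forall>i. X i \<in> S - {x}" "X \<longlonglongrightarrow> x"
  then have lim: "filterlim X (at x within S) sequentially"
    by (auto simp: filterlim_at)
  have "(\<lambda>i. LINT u|M. indicator (A (X i)) u * f u) \<longlonglongrightarrow> (LINT u|M. indicator B u * f u)"
  proof (rule integral_dominated_convergence[where w = "\<lambda>u. \<bar>f u\<bar>"])
    show "AE u in M. (\<lambda>i. indicator (A (X i)) u * f u) \<longlonglongrightarrow> indicator B u * f u"
    proof (rule AE_I2)
      fix u assume "u \<in> space M"
      then have "eventually (\<lambda>i. u \<in> A (X i) \<longleftrightarrow> u \<in> B) sequentially"
        using lim ev by (auto simp: filterlim_iff)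
      then have "eventually (\<lambda>i. indicator (A (X i)) u * f u = indicator B u * f u) sequentially"
        by eventually_elim (simp add: indicator_def)
      then show "(\<lambda>i. indicator (A (X i)) u * f u) \<longlonglongrightarrow> indicator B u * f u"
        by (rule tendsto_eventually)
    qed
    show "AE u in M. norm (indicator (A (X i)) u * f u) \<le> \<bar>f u\<bar>" for i
      by (intro AE_I2) (simp split: split_indicator)
    show "(\<lambda>u. indicator B u * f u) \<in> borel_measurable M"
      by (intro borel_measurable_integrable integrable_indicator_times f B)
    show "(\<lambda>u. indicator (A (X i)) u * f u) \<in> borel_measurable M" for i
      by (intro borel_measurable_integrable integrable_indicator_times f A)
  qed (use f in simp)
  then show "((\<lambda>v. LINT u|M. indicator (A v) u * f u) \<circ> X) \<longlonglongrightarrow> (LINT u|M. indicator B u * f u)"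
    by (simp add: comp_def)
qed

text \<open>Integration by parts from the fixed point 1/2 expresses \<open>Q v * \<kappa> v\<close>
  through integrals of Q and \<kappa> over intervals that grow towards an endpoint. Both integrands
  are integrable up to the endpoints, so these integrals converge, and with them the boundary term.
  Hence the Lebesgue--Stieltjes value equals the value by parts.\<close>

lemma LS_integral_boundary_limits:
  assumes Q: "incr_lc Q"
    and I: "has_LS_integral Q \<kappa> {0<..<1} I" and \<kappa>: "integrable (stieltjes_measure_lc Q) \<kappa>"
  obtains l r where "((\<lambda>u. Q u * \<kappa> u) \<longlongrightarrow> l) (at_right 0)" "((\<lambda>u. Q u * \<kappa> u) \<longlongrightarrow> r) (at_left 1)"
    "I = r - l - (LINT u|stieltjes_measure_lc Q. \<kappa> u)"
proof -
  let ?S = stieltjes_measure_rc and ?\<mu> = "stieltjes_measure_lc Q" and ?c = "1/2 :: real"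
  obtain G H where GH: "incr_rc G" "incr_rc H" "\<forall>u\<in>{0<..<1}. \<kappa> u = G u - H u"
    and i: "integrable (?S G) Q" "integrable (?S H) Q"
    and I: "I = (LINT u|?S G. Q u) - (LINT u|?S H. Q u)"
    using I unfolding has_LS_integral_unit_iff by blast
  define J where "J A = (LINT u|?S G. indicator A u * Q u) - (LINT u|?S H. indicator A u * Q u)" for A
  define j where "j A = (LINT u|?\<mu>. indicator A u * \<kappa> u)" for A
  have parts: "J {s<..t} = Q t * \<kappa> t - Q s * \<kappa> s - j {s..<t}" if "0 < s" "s \<le> t" "t < 1" for s t
    unfolding J_def j_def using integration_by_parts_diff[OF Q GH that] .
  have split: "(LINT u|M. f u) = (LINT u|M. indicator A u * f u) + (LINT u|M. indicator B u * f u)"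
    if "integrable M f" "sets M = sets unit_borel" "A \<union> B = {0<..<1}" "A \<inter> B = {}" "A \<in> sets unit_borel" "B \<in> sets unit_borel"
    for M A B and f :: "real \<Rightarrow> real"
  proof -
    have sp: "space M = {0<..<1}"
      using sets_eq_imp_space_eq[OF that(2)] by (simp add: space_restrict_space)
    have "A \<inter> {0<..<1} = A" "B \<inter> {0<..<1} = B" using that(3) by auto
    then have "integrable M (\<lambda>u. indicator A u * f u)" "integrable M (\<lambda>u. indicator B u * f u)"
      using that by (auto intro!: integrable_indicator_times simp: sp)
    then have "(LINT u|M. indicator A u * f u) + (LINT u|M. indicator B u * f u) =
        (LINT u|M. indicator A u * f u + indicator B u * f u)" by simp
    also have "\<dots> = (LINT u|M. f u)"
      using that(3,4) sp by (intro Bochner_Integration.integral_cong) (auto simp: indicator_def)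
    finally show ?thesis by simp
  qed
  \<comment> \<open>The point 1/2 belongs to the left piece for the integrals against G and H, and
    to the right piece for dQ, matching the pairing of \<open>{s<..t}\<close> with
    \<open>{s..<t}\<close>.\<close>
  have half: "{0<..?c} \<union> {?c<..<1} = {0<..<1}" "{0<..?c} \<inter> {?c<..<1} = {}"
    "{0<..<?c} \<union> {?c..<1} = {0<..<1}" "{0<..<?c} \<inter> {?c..<1} = {}"
    "{0<..?c} \<in> sets unit_borel" "{?c<..<1} \<in> sets unit_borel"
    "{0<..<?c} \<in> sets unit_borel" "{?c..<1} \<in> sets unit_borel"
    by (auto simp: sets_restrict_space_iff)
  have I_split: "I = J {0<..?c} + J {?c<..<1}"
    unfolding I J_def
    using split[OF i(1) sets_stieltjes_rc half(1,2,5,6)] split[OF i(2) sets_stieltjes_rc half(1,2,5,6)]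
    by simp
  have j_split: "(LINT u|?\<mu>. \<kappa> u) = j {0<..<?c} + j {?c..<1}"
    unfolding j_def using split[OF \<kappa> sets_stieltjes_lc half(3,4,7,8)] .
  have meas: "A \<inter> {0<..<1} \<in> sets unit_borel" if "A \<in> sets borel" for A :: "real set"
    using that by (subst Int_commute) (simp only: sets_restrict_space image_eqI)
  have lJ: "((\<lambda>v. J (A v)) \<longlongrightarrow> J B) (at x within S)"
    if "\<And>v. A v \<in> sets borel" "B \<in> sets borel" "\<And>u. 0 < u \<Longrightarrow> u < 1 \<Longrightarrow> eventually (\<lambda>v. u \<in> A v \<longleftrightarrow> u \<in> B) (at x within S)"
    for A B and x :: real and S
    unfolding J_def using that by (intro tendsto_diff tendsto_integral_indicator i) (auto intro: meas)
  have lj: "((\<lambda>v. j (A v)) \<longlongrightarrow> j B) (at x within S)"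
    if "\<And>v. A v \<in> sets borel" "B \<in> sets borel" "\<And>u. 0 < u \<Longrightarrow> u < 1 \<Longrightarrow> eventually (\<lambda>v. u \<in> A v \<longleftrightarrow> u \<in> B) (at x within S)"
    for A B and x :: real and S
    unfolding j_def using that by (intro tendsto_integral_indicator \<kappa>) (auto intro: meas)
  have ev1: "eventually (\<lambda>v. u < v) (at_left 1)" if "u < 1" for u :: real
    using that by (auto intro: eventually_at_leftI[of u])
  have ev0: "eventually (\<lambda>v. v < u) (at_right 0)" if "0 < u" for u :: real
    using that by (auto intro: eventually_at_rightI[of 0 u])
  have "((\<lambda>v. Q ?c * \<kappa> ?c + J {?c<..v} + j {?c..<v}) \<longlongrightarrow> Q ?c * \<kappa> ?c + J {?c<..<1} + j {?c..<1}) (at_left 1)"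
  proof (intro tendsto_intros lJ lj)
    fix u :: real assume u: "0 < u" "u < 1"
    show "eventually (\<lambda>v. u \<in> {?c<..v} \<longleftrightarrow> u \<in> {?c<..<1}) (at_left 1)"
      using ev1[OF u(2)] by eventually_elim (use u in auto)
    show "eventually (\<lambda>v. u \<in> {?c..<v} \<longleftrightarrow> u \<in> {?c..<1}) (at_left 1)"
      using ev1[OF u(2)] by eventually_elim (use u in auto)
  qed auto
  moreover have "eventually (\<lambda>v. Q ?c * \<kappa> ?c + J {?c<..v} + j {?c..<v} = Q v * \<kappa> v) (at_left 1)"
    by (rule eventually_at_leftI[of ?c]) (use parts[of ?c] in auto)
  ultimately have r: "((\<lambda>v. Q v * \<kappa> v) \<longlongrightarrow> Q ?c * \<kappa> ?c + J {?c<..<1} + j {?c..<1}) (at_left 1)"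
    by (rule Lim_transform_eventually)
  have "((\<lambda>v. Q ?c * \<kappa> ?c - J {v<..?c} - j {v..<?c}) \<longlongrightarrow> Q ?c * \<kappa> ?c - J {0<..?c} - j {0<..<?c}) (at_right 0)"
  proof (intro tendsto_intros lJ lj)
    fix u :: real assume u: "0 < u" "u < 1"
    show "eventually (\<lambda>v. u \<in> {v<..?c} \<longleftrightarrow> u \<in> {0<..?c}) (at_right 0)"
      using ev0[OF u(1)] by eventually_elim (use u in auto)
    show "eventually (\<lambda>v. u \<in> {v..<?c} \<longleftrightarrow> u \<in> {0<..<?c}) (at_right 0)"
      using ev0[OF u(1)] by eventually_elim (use u in auto)
  qed auto
  moreover have "eventually (\<lambda>v. Q ?c * \<kappa> ?c - J {v<..?c} - j {v..<?c} = Q v * \<kappa> v) (at_right 0)"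
    by (rule eventually_at_rightI[of _ ?c]) (use parts[of _ ?c] in auto)
  ultimately have l: "((\<lambda>v. Q v * \<kappa> v) \<longlongrightarrow> Q ?c * \<kappa> ?c - J {0<..?c} - j {0<..<?c}) (at_right 0)"
    by (rule Lim_transform_eventually)
  show thesis
    by (rule that[OF l r]) (simp add: I_split j_split)
qed

text \<open>Tychonoff's theorem in the form that yields a cluster point of evaluation maps
  below.\<close>

lemma compact_PiE_UNIV:
  fixes S :: "'a \<Rightarrow> 'b :: topological_space set"
  assumes "\<And>i. compact (S i)"
  shows "compact (PiE UNIV S)"
  using assms compactin_PiE[of "\<lambda>_. euclidean" UNIV S]
  by (simp add: euclidean_product_topology compactin_euclidean_iff)

section \<open>Generalized limits\<close>

text \<open>The analogue of a Banach limit for a filter: linear of norm at most 1 on the functions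
  bounded on X, and extending the limit along F. Boundedness is asked on X only, because the
  functions concerned are arbitrary outside the unit interval.\<close>

definition generalized_limit :: "'a set \<Rightarrow> 'a filter \<Rightarrow> (('a \<Rightarrow> real) \<Rightarrow> real) \<Rightarrow> bool" where
  "generalized_limit X F \<Lambda> \<longleftrightarrow>
    (\<forall>f g a b c d. (\<forall>x\<in>X. \<bar>f x\<bar> \<le> c) \<longrightarrow> (\<forall>x\<in>X. \<bar>g x\<bar> \<le> d) \<longrightarrow>
       \<Lambda> (\<lambda>x. a * f x + b * g x) = a * \<Lambda> f + b * \<Lambda> g) \<and>
    (\<forall>f c. (\<forall>x\<in>X. \<bar>f x\<bar> \<le> c) \<longrightarrow> \<bar>\<Lambda> f\<bar> \<le> c) \<and>
    (\<forall>f c l. (\<forall>x\<in>X. \<bar>f x\<bar> \<le> c) \<longrightarrow> (f \<longlongrightarrow> l) F \<longrightarrow> \<Lambda> f = l)"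

lemma generalized_limitD:
  assumes "generalized_limit X F \<Lambda>" "\<And>x. x \<in> X \<Longrightarrow> \<bar>f x\<bar> \<le> c"
  shows "(\<And>x. x \<in> X \<Longrightarrow> \<bar>g x\<bar> \<le> d) \<Longrightarrow> \<Lambda> (\<lambda>x. a * f x + b * g x) = a * \<Lambda> f + b * \<Lambda> g"
    and "\<bar>\<Lambda> f\<bar> \<le> c" and "(f \<longlongrightarrow> l) F \<Longrightarrow> \<Lambda> f = l"
  using assms unfolding generalized_limit_def by blast+

text \<open>
  A generalized limit is a cluster point, in a product of compact intervals, of the evaluation
  maps at \<open>x\<close> along \<open>F\<close>.
\<close>

lemma ex_generalized_limit:
  fixes F :: "'a filter"
  assumes F: "F \<noteq> bot" "eventually (\<lambda>x. x \<in> X) F"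
  shows "\<exists>\<Lambda>. generalized_limit X F \<Lambda>"
proof -
  define Bd where "Bd = {f :: 'a \<Rightarrow> real. \<exists>c. \<forall>x\<in>X. \<bar>f x\<bar> \<le> c}"
  have "\<forall>f\<in>Bd. \<exists>c. \<forall>x\<in>X. \<bar>f x\<bar> \<le> c" by (auto simp: Bd_def)
  then obtain b where b: "\<And>f x. f \<in> Bd \<Longrightarrow> x \<in> X \<Longrightarrow> \<bar>f x\<bar> \<le> b f" by metis
  \<comment> \<open>Unbounded functions get the coordinate set {0}, and evaluation is 0 on them, so
    that the product runs over all functions and is still compact.\<close>
  define S where "S f = (if f \<in> Bd then {- b f..b f} else {0::real})" for f
  define ev where "ev x f = (if f \<in> Bd then f x else 0)" for x f
  have "compact (PiE UNIV S)" by (rule compact_PiE_UNIV) (auto simp: S_def)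
  moreover have "filtermap ev F \<noteq> bot" using F by (simp add: filtermap_bot_iff)
  moreover have "eventually (\<lambda>\<phi>. \<phi> \<in> PiE UNIV S) (filtermap ev F)"
    unfolding eventually_filtermap using F(2)
  proof eventually_elim
    case (elim x)
    then show ?case using b[of _ x] by (force simp: S_def ev_def abs_le_iff)
  qed
  ultimately obtain \<Lambda> where \<Lambda>: "inf (nhds \<Lambda>) (filtermap ev F) \<noteq> bot"
    unfolding compact_filter by blast
  \<comment> \<open>A closed condition that holds eventually for the evaluations passes to their
    cluster point. Coordinate maps are continuous, so linearity and the norm bound are such
    conditions.\<close>
  have closed_ev: "\<Lambda> \<in> C" if "closed C" "eventually (\<lambda>x. ev x \<in> C) F" for C
  proof (rule ccontr)
    assume "\<Lambda> \<notin> C"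
    then have "eventually (\<lambda>\<phi>. \<phi> \<in> - C) (nhds \<Lambda>)"
      using that(1) by (intro eventually_nhds_in_open) auto
    moreover have "eventually (\<lambda>\<phi>. \<phi> \<in> C) (filtermap ev F)"
      using that(2) by (simp add: eventually_filtermap)
    ultimately have "eventually (\<lambda>\<phi>. False) (inf (nhds \<Lambda>) (filtermap ev F))"
      unfolding eventually_inf by (intro exI[of _ "\<lambda>\<phi>. \<phi> \<in> - C"] exI[of _ "\<lambda>\<phi>. \<phi> \<in> C"]) auto
    then show False using \<Lambda> by (simp add: eventually_False)
  qed
  have cont: "continuous_on UNIV (\<lambda>\<phi> :: ('a \<Rightarrow> real) \<Rightarrow> real. \<phi> f)" for f
    by simp
  show ?thesis
    unfolding generalized_limit_def
  proof (intro exI[of _ \<Lambda>] conjI allI impI)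
    fix f g :: "'a \<Rightarrow> real" and a b c d
    assume "\<forall>x\<in>X. \<bar>f x\<bar> \<le> c" "\<forall>x\<in>X. \<bar>g x\<bar> \<le> d"
    then have fg: "\<And>x. x \<in> X \<Longrightarrow> \<bar>f x\<bar> \<le> c" "\<And>x. x \<in> X \<Longrightarrow> \<bar>g x\<bar> \<le> d"
      by auto
    have "\<bar>a * f x + b * g x\<bar> \<le> \<bar>a\<bar> * c + \<bar>b\<bar> * d" if "x \<in> X" for x
      using mult_left_mono[OF fg(1)[OF that], of "\<bar>a\<bar>"] mult_left_mono[OF fg(2)[OF that], of "\<bar>b\<bar>"]
        abs_triangle_ineq[of "a * f x" "b * g x"] by (simp add: abs_mult)
    then have *: "f \<in> Bd" "g \<in> Bd" "(\<lambda>x. a * f x + b * g x) \<in> Bd"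
      using fg unfolding Bd_def by blast+
    have "\<Lambda> \<in> {\<phi>. \<phi> (\<lambda>x. a * f x + b * g x) = a * \<phi> f + b * \<phi> g}"
      by (rule closed_ev) (use * in \<open>auto intro!: closed_Collect_eq continuous_intros cont simp: ev_def\<close>)
    then show "\<Lambda> (\<lambda>x. a * f x + b * g x) = a * \<Lambda> f + b * \<Lambda> g" by simp
  next
    fix f :: "'a \<Rightarrow> real" and c assume f: "\<forall>x\<in>X. \<bar>f x\<bar> \<le> c"
    then have Bd: "f \<in> Bd" unfolding Bd_def by blast
    have "eventually (\<lambda>x. ev x \<in> {\<phi>. \<bar>\<phi> f\<bar> \<le> c}) F"
      using F(2) by eventually_elim (use Bd f in \<open>auto simp: ev_def\<close>)
    moreover have "closed {\<phi> :: ('a \<Rightarrow> real) \<Rightarrow> real. \<bar>\<phi> f\<bar> \<le> c}"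
      by (intro closed_Collect_le continuous_intros cont)
    ultimately show "\<bar>\<Lambda> f\<bar> \<le> c" using closed_ev by blast
  next
    fix f :: "'a \<Rightarrow> real" and c l assume f: "\<forall>x\<in>X. \<bar>f x\<bar> \<le> c" and lim: "(f \<longlongrightarrow> l) F"
    have Bd: "f \<in> Bd" using f unfolding Bd_def by blast
    \<comment> \<open>Having f converge to l makes the closed condition \<bar>\<phi> f - l\<bar>
      \<le> e hold eventually for each e > 0, though possibly not for e = 0.\<close>
    have small: "\<bar>\<Lambda> f - l\<bar> \<le> e" if "e > 0" for e
    proof -
      have "eventually (\<lambda>x. ev x \<in> {\<phi>. \<bar>\<phi> f - l\<bar> \<le> e}) F"
        using tendstoD[OF lim \<open>e > 0\<close>] by eventually_elim (use Bd in \<open>auto simp: ev_def dist_real_def\<close>)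
      moreover have "closed {\<phi> :: ('a \<Rightarrow> real) \<Rightarrow> real. \<bar>\<phi> f - l\<bar> \<le> e}"
        by (intro closed_Collect_le continuous_intros cont)
      ultimately show ?thesis using closed_ev by blast
    qed
    have "\<bar>\<Lambda> f - l\<bar> \<le> 0"
    proof (rule field_le_epsilon)
      fix e :: real assume "0 < e"
      from small[OF this] show "\<bar>\<Lambda> f - l\<bar> \<le> 0 + e" by simp
    qed
    then show "\<Lambda> f = l" by simp
  qed
qed

text \<open>Eventual uniform closeness to functions with a limit makes f Cauchy along F. It carries
  the boundary limits from \<open>Q u * \<kappa>t t u\<close> over to
  \<open>Q u * \<kappa> u\<close>.\<close>

lemma ex_limit_uniform_approx:
  fixes f :: "'a \<Rightarrow> real"
  assumes "F \<noteq> bot"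
    and approx: "\<And>\<epsilon>. \<epsilon> > 0 \<Longrightarrow> \<exists>g l. (g \<longlongrightarrow> l) F \<and> eventually (\<lambda>u. \<bar>g u - f u\<bar> \<le> \<epsilon>) F"
  shows "\<exists>l. (f \<longlongrightarrow> l) F"
proof -
  have "cauchy_filter (filtermap f F)"
    unfolding cauchy_filter_metric_filtermap
  proof (intro allI impI)
    fix e :: real assume e: "e > 0"
    obtain g l where g: "(g \<longlongrightarrow> l) F" "eventually (\<lambda>u. \<bar>g u - f u\<bar> \<le> e / 4) F"
      using approx[of "e / 4"] e by auto
    have "eventually (\<lambda>u. dist (g u) l < e / 4) F"
      using g(1) e by (intro tendstoD) auto
    with g(2) have "eventually (\<lambda>u. dist (f u) l < e / 2) F"
      by eventually_elim (unfold dist_real_def, linarith)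
    moreover have "dist (f x) (f y) < e" if "dist (f x) l < e / 2 \<and> dist (f y) l < e / 2" for x y
      using dist_triangle2[of "f x" "f y" l] that by linarith
    ultimately show "\<exists>P. eventually P F \<and> (\<forall>x y. P x \<and> P y \<longrightarrow> dist (f x) (f y) < e)"
      by (intro exI[of _ "\<lambda>u. dist (f u) l < e / 2"]) blast
  qed
  moreover have "filtermap f F \<noteq> bot" using assms(1) by (simp add: filtermap_bot_iff)
  ultimately have "\<exists>l\<in>UNIV. filtermap f F \<le> nhds l"
    using complete_uniform[of "UNIV :: real set"] complete_UNIV by auto
  then show ?thesis by (auto simp: filterlim_def)
qed

section \<open>The function spaces\<close>

lemma ladcag_integrable: "z \<in> ladcag_space \<Longrightarrow> integrable unit_lborel z"
  by (simp add: ladcag_space_def set_integrable_unit_iff)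

lemma ladcag_norm_eq: "ladcag_norm z = (LINT u|unit_lborel. \<bar>z u\<bar>)"
  by (simp add: ladcag_norm_def set_integral_unit_eq)

lemma ladcag_norm_nonneg: "0 \<le> ladcag_norm z"
  by (simp add: ladcag_norm_eq)

lemma ladcag_space_linear:
  assumes "z \<in> ladcag_space" "w \<in> ladcag_space"
  shows "(\<lambda>u. a * z u + b * w u) \<in> ladcag_space"
  unfolding ladcag_space_def set_integrable_unit_iff
proof (intro CollectI conjI ballI)
  fix u :: real assume u: "u \<in> {0<..<1}"
  then obtain l m where "(z \<longlongrightarrow> l) (at_right u)" "(w \<longlongrightarrow> m) (at_right u)"
    and c: "continuous (at_left u) z" "continuous (at_left u) w"
    using assms unfolding ladcag_space_def by blast
  then have "((\<lambda>u. a * z u + b * w u) \<longlongrightarrow> a * l + b * m) (at_right u)"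
    by (intro tendsto_intros)
  then show "\<exists>l. ((\<lambda>u. a * z u + b * w u) \<longlongrightarrow> l) (at_right u)" ..
  show "continuous (at_left u) (\<lambda>u. a * z u + b * w u)"
    using c by (intro continuous_intros)
next
  show "integrable unit_lborel (\<lambda>u. a * z u + b * w u)"
    using assms[THEN ladcag_integrable] by simp
qed

text \<open>The weight dominates both |Q| and 1. The first controls the boundary terms of
  integration by parts, the second makes \<open>t * \<kappa>t t\<close> uniformly small.\<close>

lemma LQ_space_bounds:
  assumes "\<kappa> \<in> LQ_space Q"
  shows "u \<in> {0<..<1} \<Longrightarrow> \<bar>Q u * \<kappa> u\<bar> \<le> LQ_norm Q \<kappa>" "u \<in> {0<..<1} \<Longrightarrow> \<bar>\<kappa> u\<bar> \<le> LQ_norm Q \<kappa>"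
    "(LINT u|stieltjes_measure_lc Q. \<bar>\<kappa> u\<bar>) \<le> LQ_norm Q \<kappa>" "integrable (stieltjes_measure_lc Q) \<kappa>"
    "0 \<le> LQ_norm Q \<kappa>"
proof -
  have *: "max \<bar>Q u\<bar> 1 * \<bar>\<kappa> u\<bar> \<le> LQ_norm Q \<kappa>" if "u \<in> {0<..<1}" for u
  proof -
    have "\<bar>max \<bar>Q u\<bar> 1 * \<kappa> u\<bar> \<le> (SUP u\<in>{0<..<1}. \<bar>max \<bar>Q u\<bar> 1 * \<kappa> u\<bar>)"
      using assms that by (intro cSUP_upper) (auto simp: LQ_space_def)
    then show ?thesis by (simp add: LQ_norm_def abs_mult)
  qed
  show "\<bar>Q u * \<kappa> u\<bar> \<le> LQ_norm Q \<kappa>" if "u \<in> {0<..<1}"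
    using *[OF that] mult_right_mono[of "\<bar>Q u\<bar>" "max \<bar>Q u\<bar> 1" "\<bar>\<kappa> u\<bar>"] by (simp add: abs_mult)
  show 1: "\<bar>\<kappa> u\<bar> \<le> LQ_norm Q \<kappa>" if "u \<in> {0<..<1}" for u
    using *[OF that] mult_right_mono[of 1 "max \<bar>Q u\<bar> 1" "\<bar>\<kappa> u\<bar>"] by simp
  show "(LINT u|stieltjes_measure_lc Q. \<bar>\<kappa> u\<bar>) \<le> LQ_norm Q \<kappa>"
    by (simp add: LQ_norm_def)
  show "integrable (stieltjes_measure_lc Q) \<kappa>"
    using assms by (simp add: LQ_space_def)
  show "0 \<le> LQ_norm Q \<kappa>" using 1[of "1/2"] by simp
qed

lemma LQ_space_linear:
  assumes "\<kappa> \<in> LQ_space Q" "\<eta> \<in> LQ_space Q"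
  shows "(\<lambda>u. a * \<kappa> u + b * \<eta> u) \<in> LQ_space Q"
  unfolding LQ_space_def
proof (intro CollectI conjI)
  obtain c d where cd: "\<And>u. u \<in> {0<..<1} \<Longrightarrow> \<bar>max \<bar>Q u\<bar> 1 * \<kappa> u\<bar> \<le> c"
      "\<And>u. u \<in> {0<..<1} \<Longrightarrow> \<bar>max \<bar>Q u\<bar> 1 * \<eta> u\<bar> \<le> d"
    using assms unfolding LQ_space_def bdd_above_def by fast
  have "\<bar>max \<bar>Q u\<bar> 1 * (a * \<kappa> u + b * \<eta> u)\<bar> \<le> \<bar>a\<bar> * c + \<bar>b\<bar> * d" if "u \<in> {0<..<1}" for u
  proof -
    have "max \<bar>Q u\<bar> 1 * (a * \<kappa> u + b * \<eta> u) = a * (max \<bar>Q u\<bar> 1 * \<kappa> u) + b * (max \<bar>Q u\<bar> 1 * \<eta> u)"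
      by (simp add: algebra_simps)
    also have "\<bar>\<dots>\<bar> \<le> \<bar>a\<bar> * \<bar>max \<bar>Q u\<bar> 1 * \<kappa> u\<bar> + \<bar>b\<bar> * \<bar>max \<bar>Q u\<bar> 1 * \<eta> u\<bar>"
      unfolding abs_mult[of a, symmetric] abs_mult[of b, symmetric] by (rule abs_triangle_ineq)
    also have "\<dots> \<le> \<bar>a\<bar> * c + \<bar>b\<bar> * d"
      by (intro add_mono mult_left_mono cd that abs_ge_zero)
    finally show ?thesis .
  qed
  then show "bdd_above ((\<lambda>u. \<bar>max \<bar>Q u\<bar> 1 * (a * \<kappa> u + b * \<eta> u)\<bar>) ` {0<..<1})"
    by (intro bdd_aboveI2)
  show "integrable (stieltjes_measure_lc Q) (\<lambda>u. a * \<kappa> u + b * \<eta> u)"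
    using assms[THEN LQ_space_bounds(4)] by simp
qed

text \<open>A real supremum is informative only for a nonempty bounded family; therefore even the
  lower bound 0 goes through the bound c.\<close>

lemma Linf_norm_le:
  assumes "I \<noteq> {}" "\<And>i. i \<in> I \<Longrightarrow> \<bar>f i\<bar> \<le> c"
  shows "0 \<le> Linf_norm I f" "Linf_norm I f \<le> c"
proof -
  obtain i where i: "i \<in> I" using assms(1) by auto
  have "\<bar>f i\<bar> \<le> Linf_norm I f"
    unfolding Linf_norm_def using assms(2) i by (intro cSUP_upper bdd_aboveI2) auto
  then show "0 \<le> Linf_norm I f" by simp
  show "Linf_norm I f \<le> c"
    unfolding Linf_norm_def using assms by (intro cSUP_least) auto
qed

lemma Linf_spaceI: "(\<And>i. i \<in> I \<Longrightarrow> \<bar>f i\<bar> \<le> c) \<Longrightarrow> f \<in> Linf_space I"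
  unfolding Linf_space_def mem_Collect_eq by (rule bdd_aboveI2)

section \<open>Uniform Hadamard differentiability\<close>

lemma LQM_spaceD:
  assumes "K \<in> LQM_space Q M"
  shows "K \<in> LQ_space Q" "M-lipschitz_on {0<..<1} K" "0 \<le> M"
  using assms lipschitz_on_nonneg by (auto simp: LQM_space_def)

lemma lipschitz_on_diff_real:
  fixes f g :: "real \<Rightarrow> real"
  assumes "L-lipschitz_on X f" "M-lipschitz_on X g"
  shows "(L + M)-lipschitz_on X (\<lambda>x. f x - g x)"
  using lipschitz_on_add[OF assms(1) lipschitz_on_minus[OF assms(2)]] by simp

text \<open>
  With \<open>N = K + t \<kappa>\<^sub>t\<close>, the difference quotient minus the derivative at \<open>(z\<^sub>t, \<kappa>\<^sub>t)\<close> is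
  \<open>\<integral> z\<^sub>t d(N - K)\<close>. Here \<open>N - K\<close> is uniformly small with Lipschitz constant at most \<open>2M\<close>.
\<close>

lemma hadamard_remainder_uniform:
  fixes Q :: "real \<Rightarrow> real" and \<sigma> :: "'i \<Rightarrow> real"
  assumes Q: "Q \<in> ladcag_space"
    and B: "\<And>i. i \<in> I \<Longrightarrow> B i \<in> sub_intervals" and \<sigma>: "\<And>i. i \<in> I \<Longrightarrow> \<bar>\<sigma> i\<bar> \<le> 1"
    and \<phi>: "\<And>q K i. i \<in> I \<Longrightarrow> \<phi> q K i = \<sigma> i * LS_integral q K (B i)"
    and D: "\<And>K z \<kappa> i. i \<in> I \<Longrightarrow> D K z \<kappa> i = e \<kappa> i + \<phi> z K i"
    and e_LS: "\<And>L \<kappa> i. \<kappa> \<in> LQ_space Q \<Longrightarrow> L-lipschitz_on {0<..<1} \<kappa> \<Longrightarrow> i \<in> I \<Longrightarrow>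
      e \<kappa> i = \<sigma> i * LS_integral Q \<kappa> (B i)"
    and path: "hadamard_path Q F zt \<kappa>t z \<kappa>" and \<epsilon>: "\<epsilon> > 0"
  shows "\<forall>\<^sub>F t in F. \<forall>K\<in>LQM_space Q M. (\<lambda>u. K u + t * \<kappa>t t u) \<in> LQM_space Q M \<longrightarrow>
    (\<forall>i\<in>I. \<bar>(\<phi> (\<lambda>u. Q u + t * zt t u) (\<lambda>u. K u + t * \<kappa>t t u) i - \<phi> Q K i) / t
               - D K (zt t) (\<kappa>t t) i\<bar> \<le> \<epsilon>)"
proof -
  \<comment> \<open>The absolute value makes L nonnegative before any K is at hand: only a member of
    \<open>LQM_space Q M\<close> shows that M is.\<close>
  define L where "L = 2 * \<bar>M\<bar>"
  have L: "0 \<le> L" by (simp add: L_def)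
  have z: "z \<in> ladcag_space" and \<kappa>: "\<kappa> \<in> LQ_space Q"
    using path by (auto simp: hadamard_path_def)
  have z_lim: "((\<lambda>t. ladcag_norm (\<lambda>u. zt t u - z u)) \<longlongrightarrow> 0) F"
    and \<kappa>_lim: "((\<lambda>t. LQ_norm Q (\<lambda>u. \<kappa>t t u - \<kappa> u)) \<longlongrightarrow> 0) F"
    and mem: "\<forall>\<^sub>F t in F. zt t \<in> ladcag_space \<and> \<kappa>t t \<in> LQ_space Q \<and> (\<lambda>u. Q u + t * zt t u) \<in> ladcag_space"
    using path by (auto simp: hadamard_path_def)
  have F: "F \<le> at 0" using path by (simp add: hadamard_path_def)
  have nz: "\<forall>\<^sub>F t in F. t \<noteq> 0"
    using F by (rule filter_leD) (simp add: eventually_at_filter)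
  have t_lim: "((\<lambda>t. t) \<longlongrightarrow> 0) F"
    using F tendsto_ident_at by (rule tendsto_mono)
  \<comment> \<open>Chosen for the limit z and the constant L, hence before t, K and i.\<close>
  obtain \<delta> where \<delta>: "\<delta> > 0" "\<And>(K :: real \<Rightarrow> real) A. L-lipschitz_on {0<..<1} K \<Longrightarrow>
     (\<And>u. u\<in>{0<..<1} \<Longrightarrow> \<bar>K u\<bar> \<le> \<delta>) \<Longrightarrow> A \<in> sub_intervals \<Longrightarrow> \<bar>LS_integral z K A\<bar> \<le> \<epsilon> / 2"
    by (rule vanishing_integralsE[OF vanishing_integrals_integrable[OF L ladcag_integrable[OF z]], of "\<epsilon> / 2"])
      (use \<epsilon> in auto)
  \<comment> \<open>A bound for |\<open>\<kappa>t t\<close>| once its distance to \<kappa> is below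
    1; then \<bar>t\<bar> < \<delta> / c brings N - K below \<delta>.\<close>
  define c where "c = LQ_norm Q \<kappa> + 1"
  have c: "c > 0" using LQ_space_bounds(5)[OF \<kappa>] by (simp add: c_def)
  have ev1: "\<forall>\<^sub>F t in F. ladcag_norm (\<lambda>u. zt t u - z u) < \<epsilon> / (2 * (L + 1))"
    using z_lim \<epsilon> L by (intro order_tendstoD) auto
  have ev2: "\<forall>\<^sub>F t in F. LQ_norm Q (\<lambda>u. \<kappa>t t u - \<kappa> u) < 1"
    using \<kappa>_lim by (intro order_tendstoD) auto
  have ev3: "\<forall>\<^sub>F t in F. \<bar>t\<bar> < \<delta> / c"
    using tendstoD[OF t_lim, of "\<delta> / c"] \<delta>(1) c by simp
  show ?thesis
    using mem nz ev1 ev2 ev3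
  proof eventually_elim
    case (elim t)
    note zt = conjunct1[OF elim(1)] and \<kappa>t = conjunct1[OF conjunct2[OF elim(1)]] and t0 = elim(2)
    show ?case
    proof (intro ballI impI)
      fix K i assume K: "K \<in> LQM_space Q M" and N: "(\<lambda>u. K u + t * \<kappa>t t u) \<in> LQM_space Q M" and i: "i \<in> I"
      define N where "N u = K u + t * \<kappa>t t u" for u
      have lip_K: "M-lipschitz_on {0<..<1} K" and lip_N: "M-lipschitz_on {0<..<1} N" and M: "0 \<le> M"
        using LQM_spaceD[OF K] LQM_spaceD[OF N] by (simp_all add: N_def)
      have lip_d: "L-lipschitz_on {0<..<1} (\<lambda>u. N u - K u)"
        using lipschitz_on_diff_real[OF lip_N lip_K] M by (simp add: L_def)
      have \<kappa>t_eq: "\<kappa>t t u = (1 / t) * (N u - K u)" for u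
        using t0 by (simp add: N_def)
      \<comment> \<open>This constant may blow up as t tends to 0. It only serves to identify
        \<open>e\<close> with an integral at a fixed t, which is why \<open>e_LS\<close> is assumed
        for every Lipschitz constant.\<close>
      have lip_\<kappa>t: "(\<bar>1 / t\<bar> * L)-lipschitz_on {0<..<1} (\<kappa>t t)"
        unfolding \<kappa>t_eq[abs_def] by (intro lipschitz_on_cmult_real lip_d)
      note Bi = sub_intervals_sets[OF B[OF i]]
      note iQ = ladcag_integrable[OF Q] and iz = ladcag_integrable[OF z] and izt = ladcag_integrable[OF zt]
      have diff: "LS_integral f (\<lambda>u. N u - K u) (B i) = LS_integral f N (B i) - LS_integral f K (B i)"
        if "integrable unit_lborel f" for f
        using has_LS_integral_diff_integrator[OF
            has_LS_integral_LS_integral[OF LS_integrable_lipschitz[OF lip_N that Bi]]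
            has_LS_integral_LS_integral[OF LS_integrable_lipschitz[OF lip_K that Bi]]]
        by (rule LS_integral_eq)
      have scale: "LS_integral Q (\<kappa>t t) (B i) = (1 / t) * LS_integral Q (\<lambda>u. N u - K u) (B i)"
        unfolding \<kappa>t_eq[abs_def]
        by (intro LS_integral_eq has_LS_integral_cmult_integrator has_LS_integral_LS_integral
            LS_integrable_lipschitz[OF lip_d iQ Bi])
      have "LS_integral (\<lambda>u. Q u + t * zt t u) N (B i) = LS_integral Q N (B i) + t * LS_integral (zt t) N (B i)"
        using LS_integral_lipschitz_linear[OF lip_N iQ izt Bi, of 1 t] by simp
      then have "(\<phi> (\<lambda>u. Q u + t * zt t u) N i - \<phi> Q K i) / t - D K (zt t) (\<kappa>t t) i =
          \<sigma> i * LS_integral (zt t) (\<lambda>u. N u - K u) (B i)"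
        using t0 by (simp add: \<phi>[OF i] D[OF i] e_LS[OF \<kappa>t lip_\<kappa>t i] scale diff[OF iQ] diff[OF izt] field_simps)
      also have "\<bar>\<dots>\<bar> \<le> \<bar>LS_integral (zt t) (\<lambda>u. N u - K u) (B i)\<bar>"
        using mult_right_mono[OF \<sigma>[OF i] abs_ge_zero] by (simp add: abs_mult)
      also have "LS_integral (zt t) (\<lambda>u. N u - K u) (B i) =
          LS_integral z (\<lambda>u. N u - K u) (B i) + LS_integral (\<lambda>u. zt t u - z u) (\<lambda>u. N u - K u) (B i)"
        using LS_integral_lipschitz_linear[OF lip_d iz _ Bi, of "\<lambda>u. zt t u - z u" 1 1] iz izt by simp
      also have "\<bar>\<dots>\<bar> \<le> \<epsilon> / 2 + \<epsilon> / 2"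
      proof (rule order_trans[OF abs_triangle_ineq add_mono])
        show "\<bar>LS_integral z (\<lambda>u. N u - K u) (B i)\<bar> \<le> \<epsilon> / 2"
        proof (rule \<delta>(2)[OF lip_d _ B[OF i]])
          fix u :: real assume u: "u \<in> {0<..<1}"
          have "(\<lambda>u. \<kappa>t t u - \<kappa> u) \<in> LQ_space Q"
            using LQ_space_linear[OF \<kappa>t \<kappa>, of 1 "-1"] by simp
          from LQ_space_bounds(2)[OF this u] LQ_space_bounds(2)[OF \<kappa> u] elim(4)
          have "\<bar>\<kappa>t t u\<bar> \<le> c" unfolding c_def by linarith
          then have "\<bar>t\<bar> * \<bar>\<kappa>t t u\<bar> \<le> \<delta> / c * c"
            using elim(5) by (intro mult_mono) auto
          then show "\<bar>N u - K u\<bar> \<le> \<delta>" using c by (simp add: N_def abs_mult)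
        qed
        have "\<bar>LS_integral (\<lambda>u. zt t u - z u) (\<lambda>u. N u - K u) (B i)\<bar> \<le> L * ladcag_norm (\<lambda>u. zt t u - z u)"
          unfolding ladcag_norm_eq using iz izt by (intro LS_integral_lipschitz_bound[OF lip_d _ Bi]) auto
        also have "\<dots> \<le> L * (\<epsilon> / (2 * (L + 1)))"
          using elim(3) L by (intro mult_left_mono) auto
        also have "\<dots> \<le> \<epsilon> / 2" using L \<epsilon> by (simp add: field_simps)
        finally show "\<bar>LS_integral (\<lambda>u. zt t u - z u) (\<lambda>u. N u - K u) (B i)\<bar> \<le> \<epsilon> / 2" .
      qed
      finally show "\<bar>(\<phi> (\<lambda>u. Q u + t * zt t u) (\<lambda>u. K u + t * \<kappa>t t u) i - \<phi> Q K i) / t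
               - D K (zt t) (\<kappa>t t) i\<bar> \<le> \<epsilon>"
        by (simp add: N_def[abs_def])
    qed
  qed
qed

text \<open>A common criterion for both maps: an index carries a domain \<open>B i\<close> and an
  orientation \<open>\<sigma> i\<close>, and \<open>e\<close> is the part of the derivative that
  depends on \<kappa>. It must be linear and bounded on all of \<open>LQ_space Q\<close>, but be an
  actual integral only for Lipschitz \<kappa>, which leaves room for an extension. Boundedness of D
  then carries the remainder estimate from moving to fixed directions.\<close>

lemma unif_hadamard_derivativeI:
  fixes Q :: "real \<Rightarrow> real" and \<sigma> :: "'i \<Rightarrow> real"
  assumes Q: "Q \<in> ladcag_space" and I: "I \<noteq> {}"
    and B: "\<And>i. i \<in> I \<Longrightarrow> B i \<in> sub_intervals" and \<sigma>: "\<And>i. i \<in> I \<Longrightarrow> \<bar>\<sigma> i\<bar> \<le> 1"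
    and \<phi>: "\<And>q K i. i \<in> I \<Longrightarrow> \<phi> q K i = \<sigma> i * LS_integral q K (B i)"
    and D: "\<And>K z \<kappa> i. i \<in> I \<Longrightarrow> D K z \<kappa> i = e \<kappa> i + \<phi> z K i"
    and e_linear: "\<And>\<kappa> \<eta> a b i. \<kappa> \<in> LQ_space Q \<Longrightarrow> \<eta> \<in> LQ_space Q \<Longrightarrow> i \<in> I \<Longrightarrow>
      e (\<lambda>u. a * \<kappa> u + b * \<eta> u) i = a * e \<kappa> i + b * e \<eta> i"
    and e_bound: "\<And>\<kappa> i. \<kappa> \<in> LQ_space Q \<Longrightarrow> i \<in> I \<Longrightarrow> \<bar>e \<kappa> i\<bar> \<le> C * LQ_norm Q \<kappa>"
    and e_LS: "\<And>L \<kappa> i. \<kappa> \<in> LQ_space Q \<Longrightarrow> L-lipschitz_on {0<..<1} \<kappa> \<Longrightarrow> i \<in> I \<Longrightarrow>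
      e \<kappa> i = \<sigma> i * LS_integral Q \<kappa> (B i)"
  shows "unif_hadamard_derivative I Q M \<phi> D"
proof -
  have \<phi>_bound: "\<bar>\<phi> q K i\<bar> \<le> M * ladcag_norm q" if "q \<in> ladcag_space" "K \<in> LQM_space Q M" "i \<in> I" for q K i
  proof -
    have "\<bar>\<phi> q K i\<bar> \<le> \<bar>LS_integral q K (B i)\<bar>"
      using mult_right_mono[OF \<sigma>[OF that(3)] abs_ge_zero] by (simp add: abs_mult \<phi>[OF that(3)])
    also have "\<dots> \<le> M * ladcag_norm q"
      unfolding ladcag_norm_eq using that LQM_spaceD[OF that(2)]
      by (intro LS_integral_lipschitz_bound ladcag_integrable sub_intervals_sets B)
    finally show ?thesis .
  qed
  have D_linear: "D K (\<lambda>u. a * z u + b * w u) (\<lambda>u. a * \<kappa> u + b * \<eta> u) i = a * D K z \<kappa> i + b * D K w \<eta> i"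
    if "K \<in> LQM_space Q M" "z \<in> ladcag_space" "w \<in> ladcag_space" "\<kappa> \<in> LQ_space Q" "\<eta> \<in> LQ_space Q" "i \<in> I"
    for K z w \<kappa> \<eta> a b i
    using LS_integral_lipschitz_linear[OF LQM_spaceD(2)[OF that(1)] ladcag_integrable[OF that(2)]
        ladcag_integrable[OF that(3)] sub_intervals_sets[OF B[OF that(6)]], of a b]
    by (simp add: D[OF that(6)] \<phi>[OF that(6)] e_linear[OF that(4-6)] algebra_simps)
  have D_bound: "\<bar>D K z \<kappa> i\<bar> \<le> (\<bar>C\<bar> + M) * (ladcag_norm z + LQ_norm Q \<kappa>)"
    if "K \<in> LQM_space Q M" "z \<in> ladcag_space" "\<kappa> \<in> LQ_space Q" "i \<in> I" for K z \<kappa> i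
  proof -
    have M: "0 \<le> M" by (rule LQM_spaceD(3)[OF that(1)])
    note n = ladcag_norm_nonneg[of z] LQ_space_bounds(5)[OF that(3)]
    have "\<bar>D K z \<kappa> i\<bar> \<le> \<bar>e \<kappa> i\<bar> + \<bar>\<phi> z K i\<bar>"
      unfolding D[OF that(4)] by (rule abs_triangle_ineq)
    also have "\<bar>e \<kappa> i\<bar> \<le> \<bar>C\<bar> * LQ_norm Q \<kappa>"
      using e_bound[OF that(3,4)] mult_right_mono[OF abs_ge_self n(2)] by (rule order_trans)
    also have "\<bar>\<phi> z K i\<bar> \<le> M * ladcag_norm z" using that by (intro \<phi>_bound)
    also have "\<bar>C\<bar> * LQ_norm Q \<kappa> + M * ladcag_norm z \<le> (\<bar>C\<bar> + M) * (ladcag_norm z + LQ_norm Q \<kappa>)"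
      using n M by (simp add: algebra_simps)
    finally show ?thesis by simp
  qed
  have "bounded_linear_LQ I Q (D K)" if K: "K \<in> LQM_space Q M" for K
    unfolding bounded_linear_LQ_def
  proof (intro conjI ballI allI exI[of _ "\<bar>C\<bar> + M"])
    show "D K z \<kappa> \<in> Linf_space I" if "z \<in> ladcag_space" "\<kappa> \<in> LQ_space Q" for z \<kappa>
      using D_bound[OF K that] by (rule Linf_spaceI)
    show "Linf_norm I (D K z \<kappa>) \<le> (\<bar>C\<bar> + M) * (ladcag_norm z + LQ_norm Q \<kappa>)"
      if "z \<in> ladcag_space" "\<kappa> \<in> LQ_space Q" for z \<kappa>
      using D_bound[OF K that] by (rule Linf_norm_le(2)[OF I])
  qed (rule D_linear[OF K])
  moreover have "\<phi> q K \<in> Linf_space I" if "q \<in> ladcag_space" "K \<in> LQM_space Q M" for q K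
    using \<phi>_bound[OF that] by (rule Linf_spaceI)
  moreover have
    "\<forall>\<^sub>F t in F. \<forall>K\<in>LQM_space Q M. (\<lambda>u. K u + t * \<kappa>t t u) \<in> LQM_space Q M \<longrightarrow>
      Linf_norm I (\<lambda>i. (\<phi> (\<lambda>u. Q u + t * zt t u) (\<lambda>u. K u + t * \<kappa>t t u) i - \<phi> Q K i) / t
               - D K (zt t) (\<kappa>t t) i) < \<epsilon>"
    if "hadamard_path Q F zt \<kappa>t z \<kappa>" "\<epsilon> > 0" for F zt \<kappa>t z \<kappa> \<epsilon>
  proof -
    \<comment> \<open>Half of \<epsilon>, because a pointwise bound survives the supremum only as a
      weak inequality.\<close>
    have "\<forall>\<^sub>F t in F. \<forall>K\<in>LQM_space Q M. (\<lambda>u. K u + t * \<kappa>t t u) \<in> LQM_space Q M \<longrightarrow>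
      (\<forall>i\<in>I. \<bar>(\<phi> (\<lambda>u. Q u + t * zt t u) (\<lambda>u. K u + t * \<kappa>t t u) i - \<phi> Q K i) / t
               - D K (zt t) (\<kappa>t t) i\<bar> \<le> \<epsilon> / 2)"
      by (rule hadamard_remainder_uniform[OF Q B \<sigma> \<phi> D e_LS that(1)]) (use that(2) in auto)
    then show ?thesis
    proof eventually_elim
      case (elim t)
      show ?case
      proof (intro ballI impI)
        fix K assume "K \<in> LQM_space Q M" "(\<lambda>u. K u + t * \<kappa>t t u) \<in> LQM_space Q M"
        with elim have "Linf_norm I (\<lambda>i. (\<phi> (\<lambda>u. Q u + t * zt t u) (\<lambda>u. K u + t * \<kappa>t t u) i - \<phi> Q K i) / t
               - D K (zt t) (\<kappa>t t) i) \<le> \<epsilon> / 2"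
          by (intro Linf_norm_le(2)[OF I]) blast
        then show "Linf_norm I (\<lambda>i. (\<phi> (\<lambda>u. Q u + t * zt t u) (\<lambda>u. K u + t * \<kappa>t t u) i - \<phi> Q K i) / t
               - D K (zt t) (\<kappa>t t) i) < \<epsilon>"
          using that(2) by simp
      qed
    qed
  qed
  moreover have "((\<lambda>t. Linf_norm I (\<lambda>i.
      (\<phi> (\<lambda>u. Q u + t * zt t u) (\<lambda>u. K u + t * \<kappa>t t u) i - \<phi> Q K i) / t - D K z \<kappa> i)) \<longlongrightarrow> 0) F"
    if path: "hadamard_path Q F zt \<kappa>t z \<kappa>" and K: "K \<in> LQM_space Q M" and adm: "hadamard_admissible Q M F \<kappa>t K"
    for F zt \<kappa>t z \<kappa> K
  proof (rule tendstoI)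
    fix \<epsilon> :: real assume \<epsilon>: "\<epsilon> > 0"
    have z: "z \<in> ladcag_space" and \<kappa>: "\<kappa> \<in> LQ_space Q"
      and z_lim: "((\<lambda>t. ladcag_norm (\<lambda>u. zt t u - z u)) \<longlongrightarrow> 0) F"
      and \<kappa>_lim: "((\<lambda>t. LQ_norm Q (\<lambda>u. \<kappa>t t u - \<kappa> u)) \<longlongrightarrow> 0) F"
      and mem: "\<forall>\<^sub>F t in F. zt t \<in> ladcag_space \<and> \<kappa>t t \<in> LQ_space Q \<and> (\<lambda>u. Q u + t * zt t u) \<in> ladcag_space"
      using path by (auto simp: hadamard_path_def)
    \<comment> \<open>By linearity and \<open>D_bound\<close> this majorizes the change of the
      derivative when the moving directions are replaced by their limits.\<close>
    have "((\<lambda>t. (\<bar>C\<bar> + M) * (ladcag_norm (\<lambda>u. zt t u - z u) + LQ_norm Q (\<lambda>u. \<kappa>t t u - \<kappa> u)))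
        \<longlongrightarrow> (\<bar>C\<bar> + M) * (0 + 0)) F"
      by (intro tendsto_intros z_lim \<kappa>_lim)
    then have "\<forall>\<^sub>F t in F. (\<bar>C\<bar> + M) * (ladcag_norm (\<lambda>u. zt t u - z u) + LQ_norm Q (\<lambda>u. \<kappa>t t u - \<kappa> u)) < \<epsilon> / 4"
      using \<epsilon> by (intro order_tendstoD) auto
    moreover have "\<forall>\<^sub>F t in F. \<forall>K\<in>LQM_space Q M. (\<lambda>u. K u + t * \<kappa>t t u) \<in> LQM_space Q M \<longrightarrow>
      (\<forall>i\<in>I. \<bar>(\<phi> (\<lambda>u. Q u + t * zt t u) (\<lambda>u. K u + t * \<kappa>t t u) i - \<phi> Q K i) / t
               - D K (zt t) (\<kappa>t t) i\<bar> \<le> \<epsilon> / 4)"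
      by (rule hadamard_remainder_uniform[OF Q B \<sigma> \<phi> D e_LS path]) (use \<epsilon> in auto)
    ultimately show "\<forall>\<^sub>F t in F. dist (Linf_norm I (\<lambda>i.
      (\<phi> (\<lambda>u. Q u + t * zt t u) (\<lambda>u. K u + t * \<kappa>t t u) i - \<phi> Q K i) / t - D K z \<kappa> i)) 0 < \<epsilon>"
      using mem adm[unfolded hadamard_admissible_def]
    proof eventually_elim
      case (elim t)
      let ?q = "\<lambda>i. (\<phi> (\<lambda>u. Q u + t * zt t u) (\<lambda>u. K u + t * \<kappa>t t u) i - \<phi> Q K i) / t"
      have "\<bar>?q i - D K z \<kappa> i\<bar> \<le> \<epsilon> / 2" if i: "i \<in> I" for i
      proof -
        have zt: "zt t \<in> ladcag_space" and \<kappa>t: "\<kappa>t t \<in> LQ_space Q" using elim(3) by auto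
        have d: "(\<lambda>u. zt t u - z u) \<in> ladcag_space" "(\<lambda>u. \<kappa>t t u - \<kappa> u) \<in> LQ_space Q"
          using ladcag_space_linear[OF zt z, of 1 "-1"] LQ_space_linear[OF \<kappa>t \<kappa>, of 1 "-1"] by simp_all
        have "\<bar>D K (\<lambda>u. zt t u - z u) (\<lambda>u. \<kappa>t t u - \<kappa> u) i\<bar> \<le> \<epsilon> / 4"
          using D_bound[OF K d i] elim(1) by linarith
        moreover have "D K (\<lambda>u. zt t u - z u) (\<lambda>u. \<kappa>t t u - \<kappa> u) i = D K (zt t) (\<kappa>t t) i - D K z \<kappa> i"
          using D_linear[OF K zt z \<kappa>t \<kappa> i, of 1 "-1"] by simp
        moreover have "\<bar>?q i - D K (zt t) (\<kappa>t t) i\<bar> \<le> \<epsilon> / 4"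
          using elim(2,4) K i by blast
        ultimately show ?thesis by linarith
      qed
      then have "0 \<le> Linf_norm I (\<lambda>i. ?q i - D K z \<kappa> i)" "Linf_norm I (\<lambda>i. ?q i - D K z \<kappa> i) \<le> \<epsilon> / 2"
        by (intro Linf_norm_le[OF I]; blast)+
      then show ?case using \<epsilon> by (simp add: dist_real_def)
    qed
  qed
  ultimately show ?thesis
    unfolding unif_hadamard_derivative_def by blast
qed

text \<open>Existence of the integral is not a linear condition on \<kappa>: a sum may be integrable
  when its summands are not. The expression by parts is valid in both cases, and linearity and
  boundedness are read off from it.\<close>

lemma int_dir_Ioc_eq:
  assumes Q: "incr_lc Q"
    and st: "0 < s" "s \<le> t" "t < 1"
  shows "int_dir_Ioc Q \<kappa> s t =
    Q t * \<kappa> t - Q s * \<kappa> s - (LINT u|stieltjes_measure_lc Q. indicator {s..<t} u * \<kappa> u)"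
proof (cases "LS_integrable Q \<kappa> {s<..t}")
  case True
  then show ?thesis
    using has_LS_integral_by_parts[OF Q has_LS_integral_LS_integral st] by (simp add: int_dir_Ioc_def)
next
  case False
  then show ?thesis by (simp add: int_dir_Ioc_def set_lebesgue_integral_def)
qed

lemma int_dir_Ioc_linear:
  assumes Q: "incr_lc Q"
    and st: "0 < s" "s \<le> t" "t < 1" and "\<kappa> \<in> LQ_space Q" "\<eta> \<in> LQ_space Q"
  shows "int_dir_Ioc Q (\<lambda>u. a * \<kappa> u + b * \<eta> u) s t = a * int_dir_Ioc Q \<kappa> s t + b * int_dir_Ioc Q \<eta> s t"
proof -
  have i: "integrable (stieltjes_measure_lc Q) (\<lambda>u. indicator {s..<t} u * f u)" if "f \<in> LQ_space Q" for f
    using LQ_space_bounds(4)[OF that] st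
    by (intro integrable_indicator_times) (auto simp: Int_absorb2 subset_iff)
  have "(LINT u|stieltjes_measure_lc Q. indicator {s..<t} u * (a * \<kappa> u + b * \<eta> u)) =
      (LINT u|stieltjes_measure_lc Q. a * (indicator {s..<t} u * \<kappa> u) + b * (indicator {s..<t} u * \<eta> u))"
    by (simp add: algebra_simps)
  also have "\<dots> = a * (LINT u|stieltjes_measure_lc Q. indicator {s..<t} u * \<kappa> u) +
      b * (LINT u|stieltjes_measure_lc Q. indicator {s..<t} u * \<eta> u)"
    using i assms by simp
  finally show ?thesis
    by (simp add: int_dir_Ioc_eq[OF Q st, of "\<lambda>u. a * \<kappa> u + b * \<eta> u"] int_dir_Ioc_eq[OF Q st, of \<kappa>]
        int_dir_Ioc_eq[OF Q st, of \<eta>] algebra_simps)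
qed

text \<open>The two boundary terms and the integral against dQ are each at most the norm, hence the
  factor 3.\<close>

lemma int_dir_Ioc_bound:
  assumes Q: "incr_lc Q"
    and st: "0 < s" "s \<le> t" "t < 1" and \<kappa>: "\<kappa> \<in> LQ_space Q"
  shows "\<bar>int_dir_Ioc Q \<kappa> s t\<bar> \<le> 3 * LQ_norm Q \<kappa>"
proof -
  let ?\<mu> = "stieltjes_measure_lc Q"
  have i: "integrable ?\<mu> \<kappa>" by (rule LQ_space_bounds(4)[OF \<kappa>])
  have "\<bar>LINT u|?\<mu>. indicator {s..<t} u * \<kappa> u\<bar> \<le> (LINT u|?\<mu>. \<bar>indicator {s..<t} u * \<kappa> u\<bar>)"
    by (rule integral_abs_bound)
  also have "\<dots> \<le> (LINT u|?\<mu>. \<bar>\<kappa> u\<bar>)"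
    using i by (intro integral_mono_AE' AE_I2) (auto split: split_indicator)
  also have "\<dots> \<le> LQ_norm Q \<kappa>" by (rule LQ_space_bounds(3)[OF \<kappa>])
  finally have "\<bar>LINT u|?\<mu>. indicator {s..<t} u * \<kappa> u\<bar> \<le> LQ_norm Q \<kappa>" .
  moreover have "\<bar>Q s * \<kappa> s\<bar> \<le> LQ_norm Q \<kappa>" "\<bar>Q t * \<kappa> t\<bar> \<le> LQ_norm Q \<kappa>"
    using st by (auto intro: LQ_space_bounds(1)[OF \<kappa>])
  moreover note int_dir_Ioc_eq[OF Q st, of \<kappa>]
  ultimately show ?thesis by linarith
qed

text \<open>Membership through Lebesgue--Stieltjes integrability also forces the boundary limits to
  exist, so both alternatives in \<open>int_dom\<close> lead to one formula.\<close>

lemma int_dom_limits: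
  assumes Q: "incr_lc Q"
    and \<kappa>: "\<kappa> \<in> int_dom Q"
  obtains l r where "((\<lambda>u. Q u * \<kappa> u) \<longlongrightarrow> l) (at_right 0)" "((\<lambda>u. Q u * \<kappa> u) \<longlongrightarrow> r) (at_left 1)"
    "int_dir Q \<kappa> = r - l - (LINT u|stieltjes_measure_lc Q. \<kappa> u)"
proof (cases "LS_integrable Q \<kappa> {0<..<1}")
  case True
  have "integrable (stieltjes_measure_lc Q) \<kappa>"
    using \<kappa> LQ_space_bounds(4) by (auto simp: int_dom_def)
  from LS_integral_boundary_limits[OF Q has_LS_integral_LS_integral[OF True] this]
  show thesis using that True by (auto simp: int_dir_def)
next
  case False
  then obtain l r where lr: "((\<lambda>u. Q u * \<kappa> u) \<longlongrightarrow> l) (at_right 0)" "((\<lambda>u. Q u * \<kappa> u) \<longlongrightarrow> r) (at_left 1)"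
    using \<kappa> by (auto simp: int_dom_def)
  show thesis
  proof (rule that[OF lr])
    show "int_dir Q \<kappa> = r - l - (LINT u|stieltjes_measure_lc Q. \<kappa> u)"
      using False tendsto_Lim[OF _ lr(1)] tendsto_Lim[OF _ lr(2)] by (simp add: int_dir_def)
  qed
qed

text \<open>For t different from 0, \<open>\<kappa>t t\<close> is 1/t times a difference of two
  M-Lipschitz functions, so \<open>Q u * \<kappa>t t u\<close> has boundary limits. Convergence in
  the norm of \<open>LQ_space Q\<close> makes these products converge uniformly, and uniform limits
  inherit the boundary limits. So every direction reached by an admissible path has a derivative
  given by the explicit formula.\<close>

lemma hadamard_direction_in_int_dom:
  assumes Q: "Q \<in> ladcag_space" "mono_on {0<..<1} Q" and K: "K \<in> LQM_space Q M"
    and path: "hadamard_path Q F zt \<kappa>t z \<kappa>" and adm: "hadamard_admissible Q M F \<kappa>t K"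
  shows "\<kappa> \<in> int_dom Q"
proof -
  have Qlc: "incr_lc Q"
    using Q by (simp add: incr_lc_def ladcag_space_def)
  have \<kappa>: "\<kappa> \<in> LQ_space Q" and F: "F \<noteq> bot" "F \<le> at 0"
    and lim: "((\<lambda>t. LQ_norm Q (\<lambda>u. \<kappa>t t u - \<kappa> u)) \<longlongrightarrow> 0) F"
    and mem: "\<forall>\<^sub>F t in F. zt t \<in> ladcag_space \<and> \<kappa>t t \<in> LQ_space Q \<and> (\<lambda>u. Q u + t * zt t u) \<in> ladcag_space"
    using path by (auto simp: hadamard_path_def)
  have nz: "\<forall>\<^sub>F t in F. t \<noteq> 0"
    using F(2) by (rule filter_leD) (simp add: eventually_at_filter)
  have approx: "\<exists>g l r. (g \<longlongrightarrow> l) (at_right 0) \<and> (g \<longlongrightarrow> r) (at_left 1) \<and>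
      (\<forall>u\<in>{0<..<1}. \<bar>g u - Q u * \<kappa> u\<bar> \<le> \<epsilon>)" if "\<epsilon> > 0" for \<epsilon>
  proof -
    have "\<forall>\<^sub>F t in F. LQ_norm Q (\<lambda>u. \<kappa>t t u - \<kappa> u) < \<epsilon>"
      using lim that by (intro order_tendstoD) auto
    with mem nz adm[unfolded hadamard_admissible_def]
    have "\<forall>\<^sub>F t in F. \<kappa>t t \<in> LQ_space Q \<and> t \<noteq> 0 \<and> (\<lambda>u. K u + t * \<kappa>t t u) \<in> LQM_space Q M \<and>
        LQ_norm Q (\<lambda>u. \<kappa>t t u - \<kappa> u) < \<epsilon>"
      by eventually_elim auto
    then obtain t where t: "\<kappa>t t \<in> LQ_space Q" "t \<noteq> 0" "(\<lambda>u. K u + t * \<kappa>t t u) \<in> LQM_space Q M"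
        "LQ_norm Q (\<lambda>u. \<kappa>t t u - \<kappa> u) < \<epsilon>"
      using eventually_happens' F(1) by blast
    have "(M + M)-lipschitz_on {0<..<1} (\<lambda>u. K u + t * \<kappa>t t u - K u)"
      by (intro lipschitz_on_diff_real LQM_spaceD(2)[OF K] LQM_spaceD(2)[OF t(3)])
    from lipschitz_on_cmult_real[OF this, of "1 / t"]
    have "(\<bar>1 / t\<bar> * (M + M))-lipschitz_on {0<..<1} (\<kappa>t t)" using t(2) by simp
    moreover have "{0<..<1} \<inter> {0<..<1} \<in> sets unit_borel"
      by (simp add: sets_restrict_space_iff)
    ultimately have "LS_integrable Q (\<kappa>t t) {0<..<1}"
      by (rule LS_integrable_lipschitz[OF _ ladcag_integrable[OF Q(1)]])
    then obtain l r where lr: "((\<lambda>u. Q u * \<kappa>t t u) \<longlongrightarrow> l) (at_right 0)" "((\<lambda>u. Q u * \<kappa>t t u) \<longlongrightarrow> r) (at_left 1)"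
      using LS_integral_boundary_limits[OF Qlc has_LS_integral_LS_integral LQ_space_bounds(4)[OF t(1)]]
      by blast
    have "(\<lambda>u. \<kappa>t t u - \<kappa> u) \<in> LQ_space Q"
      using LQ_space_linear[OF t(1) \<kappa>, of 1 "-1"] by simp
    from LQ_space_bounds(1)[OF this] t(4)
    have "\<bar>Q u * \<kappa>t t u - Q u * \<kappa> u\<bar> \<le> \<epsilon>" if "u \<in> {0<..<1}" for u
      using that by (fastforce simp: right_diff_distrib)
    with lr show ?thesis by (intro exI[of _ "\<lambda>u. Q u * \<kappa>t t u"] exI[of _ l] exI[of _ r]) auto
  qed
  have ev: "\<forall>\<^sub>F u in at_right 0. u \<in> {0<..<1::real}" "\<forall>\<^sub>F u in at_left 1. u \<in> {0<..<1::real}"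
    by (auto intro: eventually_at_rightI[of 0 1] eventually_at_leftI[of 0 1])
  have "\<exists>l. ((\<lambda>u. Q u * \<kappa> u) \<longlongrightarrow> l) (at_right 0)"
  proof (rule ex_limit_uniform_approx)
    fix \<epsilon> :: real assume "\<epsilon> > 0"
    from approx[OF this] obtain g l where g: "(g \<longlongrightarrow> l) (at_right 0)" "\<forall>u\<in>{0<..<1}. \<bar>g u - Q u * \<kappa> u\<bar> \<le> \<epsilon>"
      by blast
    have "\<forall>\<^sub>F u in at_right 0. \<bar>g u - Q u * \<kappa> u\<bar> \<le> \<epsilon>"
      using ev(1) by eventually_elim (use g(2) in blast)
    with g(1) show "\<exists>g l. (g \<longlongrightarrow> l) (at_right 0) \<and> (\<forall>\<^sub>F u in at_right 0. \<bar>g u - Q u * \<kappa> u\<bar> \<le> \<epsilon>)"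
      by blast
  qed simp
  moreover have "\<exists>r. ((\<lambda>u. Q u * \<kappa> u) \<longlongrightarrow> r) (at_left 1)"
  proof (rule ex_limit_uniform_approx)
    fix \<epsilon> :: real assume "\<epsilon> > 0"
    from approx[OF this] obtain g l where g: "(g \<longlongrightarrow> l) (at_left 1)" "\<forall>u\<in>{0<..<1}. \<bar>g u - Q u * \<kappa> u\<bar> \<le> \<epsilon>"
      by blast
    have "\<forall>\<^sub>F u in at_left 1. \<bar>g u - Q u * \<kappa> u\<bar> \<le> \<epsilon>"
      using ev(2) by eventually_elim (use g(2) in blast)
    with g(1) show "\<exists>g l. (g \<longlongrightarrow> l) (at_left 1) \<and> (\<forall>\<^sub>F u in at_left 1. \<bar>g u - Q u * \<kappa> u\<bar> \<le> \<epsilon>)"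
      by blast
  qed simp
  ultimately show ?thesis using \<kappa> by (auto simp: int_dom_def)
qed

text \<open>Generalized limits at 0 and 1 stand in for the boundary terms; they apply because
  \<open>Q u * \<kappa> u\<close> is bounded by the norm. The extension depends on their choice, but
  agrees with \<open>int_dir\<close> where ordinary limits exist.\<close>

lemma ex_int_dir_extension:
  assumes Q: "incr_lc Q"
  shows "\<exists>E. (\<forall>\<kappa>\<in>LQ_space Q. \<forall>\<eta>\<in>LQ_space Q. \<forall>a b.
        E (\<lambda>u. a * \<kappa> u + b * \<eta> u) = a * E \<kappa> + b * E \<eta>) \<and>
    (\<forall>\<kappa>\<in>LQ_space Q. \<bar>E \<kappa>\<bar> \<le> 3 * LQ_norm Q \<kappa>) \<and> (\<forall>\<kappa>\<in>int_dom Q. E \<kappa> = int_dir Q \<kappa>)"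
proof -
  let ?U = "{0<..<1::real}" and ?\<mu> = "stieltjes_measure_lc Q"
  have ev: "\<forall>\<^sub>F u in at_right 0. u \<in> ?U" "\<forall>\<^sub>F u in at_left 1. u \<in> ?U"
    by (auto intro: eventually_at_rightI[of 0 1] eventually_at_leftI[of 0 1])
  obtain \<Lambda>0 where \<Lambda>0: "generalized_limit ?U (at_right 0) \<Lambda>0"
    using ex_generalized_limit[OF _ ev(1)] by auto
  obtain \<Lambda>1 where \<Lambda>1: "generalized_limit ?U (at_left 1) \<Lambda>1"
    using ex_generalized_limit[OF _ ev(2)] by auto
  define E where "E \<kappa> = \<Lambda>1 (\<lambda>u. Q u * \<kappa> u) - \<Lambda>0 (\<lambda>u. Q u * \<kappa> u) - (LINT u|?\<mu>. \<kappa> u)" for \<kappa>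
  note b = LQ_space_bounds(1)
  show ?thesis
  proof (intro exI[of _ E] conjI ballI allI)
    fix \<kappa> \<eta> a b assume \<kappa>: "\<kappa> \<in> LQ_space Q" and \<eta>: "\<eta> \<in> LQ_space Q"
    have eq: "(\<lambda>u. Q u * (a * \<kappa> u + b * \<eta> u)) = (\<lambda>u. a * (Q u * \<kappa> u) + b * (Q u * \<eta> u))"
      by (simp add: algebra_simps)
    have "\<Lambda>1 (\<lambda>u. Q u * (a * \<kappa> u + b * \<eta> u)) = a * \<Lambda>1 (\<lambda>u. Q u * \<kappa> u) + b * \<Lambda>1 (\<lambda>u. Q u * \<eta> u)"
      unfolding eq by (rule generalized_limitD(1)[OF \<Lambda>1 b[OF \<kappa>] b[OF \<eta>]])
    moreover have "\<Lambda>0 (\<lambda>u. Q u * (a * \<kappa> u + b * \<eta> u)) = a * \<Lambda>0 (\<lambda>u. Q u * \<kappa> u) + b * \<Lambda>0 (\<lambda>u. Q u * \<eta> u)"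
      unfolding eq by (rule generalized_limitD(1)[OF \<Lambda>0 b[OF \<kappa>] b[OF \<eta>]])
    moreover have "(LINT u|?\<mu>. a * \<kappa> u + b * \<eta> u) = a * (LINT u|?\<mu>. \<kappa> u) + b * (LINT u|?\<mu>. \<eta> u)"
      using LQ_space_bounds(4)[OF \<kappa>] LQ_space_bounds(4)[OF \<eta>] by simp
    ultimately show "E (\<lambda>u. a * \<kappa> u + b * \<eta> u) = a * E \<kappa> + b * E \<eta>"
      unfolding E_def by (simp add: algebra_simps)
  next
    fix \<kappa> assume \<kappa>: "\<kappa> \<in> LQ_space Q"
    have "\<bar>LINT u|?\<mu>. \<kappa> u\<bar> \<le> LQ_norm Q \<kappa>"
      using integral_abs_bound LQ_space_bounds(3)[OF \<kappa>] by (rule order_trans)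
    moreover have "\<bar>\<Lambda>0 (\<lambda>u. Q u * \<kappa> u)\<bar> \<le> LQ_norm Q \<kappa>"
      by (rule generalized_limitD(2)[OF \<Lambda>0]) (rule b[OF \<kappa>])
    moreover have "\<bar>\<Lambda>1 (\<lambda>u. Q u * \<kappa> u)\<bar> \<le> LQ_norm Q \<kappa>"
      by (rule generalized_limitD(2)[OF \<Lambda>1]) (rule b[OF \<kappa>])
    ultimately show "\<bar>E \<kappa>\<bar> \<le> 3 * LQ_norm Q \<kappa>" unfolding E_def by linarith
  next
    fix \<kappa> assume \<kappa>: "\<kappa> \<in> int_dom Q"
    then have mem: "\<kappa> \<in> LQ_space Q" by (simp add: int_dom_def)
    obtain l r where "((\<lambda>u. Q u * \<kappa> u) \<longlongrightarrow> l) (at_right 0)" "((\<lambda>u. Q u * \<kappa> u) \<longlongrightarrow> r) (at_left 1)"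
      "int_dir Q \<kappa> = r - l - (LINT u|?\<mu>. \<kappa> u)"
      by (rule int_dom_limits[OF Q \<kappa>])
    then show "E \<kappa> = int_dir Q \<kappa>"
      using generalized_limitD(3)[OF \<Lambda>0 b[OF mem]] generalized_limitD(3)[OF \<Lambda>1 b[OF mem]] by (simp add: E_def)
  qed
qed

theorem theorem5p1:
  fixes Q :: "real \<Rightarrow> real" and M :: real
  assumes "Q \<in> ladcag_space" and "mono_on {0<..<1} Q"
  shows
    "(\<exists>D :: (real \<Rightarrow> real) \<Rightarrow> (real \<Rightarrow> real) \<Rightarrow> (real \<Rightarrow> real) \<Rightarrow> real.
        unif_hadamard_derivative (UNIV :: unit set) Q M (\<lambda>q K _. lam q K) (\<lambda>K z \<kappa> _. D K z \<kappa>) \<and>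
        (\<forall>K\<in>LQM_space Q M. \<forall>z\<in>ladcag_space. \<forall>\<kappa>\<in>int_dom Q. D K z \<kappa> = int_dir Q \<kappa> + lam z K)) \<and>
     (\<forall>F zt \<kappa>t z \<kappa>. \<forall>K\<in>LQM_space Q M.
        hadamard_path Q F zt \<kappa>t z \<kappa> \<and> hadamard_admissible Q M F \<kappa>t K \<longrightarrow> \<kappa> \<in> int_dom Q) \<and>
     unif_hadamard_derivative ({0<..<1} \<times> {0<..<1}) Q M lam_tilde (lam_tilde_deriv Q)"
proof -
  have Q: "incr_lc Q"
    using assms by (simp add: incr_lc_def ladcag_space_def)
  obtain E where E:
    "\<And>\<kappa> \<eta> a b. \<kappa> \<in> LQ_space Q \<Longrightarrow> \<eta> \<in> LQ_space Q \<Longrightarrow> E (\<lambda>u. a * \<kappa> u + b * \<eta> u) = a * E \<kappa> + b * E \<eta>"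
    "\<And>\<kappa>. \<kappa> \<in> LQ_space Q \<Longrightarrow> \<bar>E \<kappa>\<bar> \<le> 3 * LQ_norm Q \<kappa>"
    "\<And>\<kappa>. \<kappa> \<in> int_dom Q \<Longrightarrow> E \<kappa> = int_dir Q \<kappa>"
    using ex_int_dir_extension[OF Q] by metis
  have LS: "LS_integrable Q \<kappa> A" if "L-lipschitz_on {0<..<1} \<kappa>" "A \<in> sub_intervals" for L \<kappa> A
    using LS_integrable_lipschitz[OF that(1) ladcag_integrable[OF assms(1)] sub_intervals_sets[OF that(2)]] .
  have unit: "{0<..<1} \<in> sub_intervals" by (simp add: sub_intervals_def)
  have "unif_hadamard_derivative (UNIV :: unit set) Q M (\<lambda>q K _. lam q K) (\<lambda>K z \<kappa> _. E \<kappa> + lam z K)"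
  proof (rule unif_hadamard_derivativeI[OF assms(1), where B = "\<lambda>_. {0<..<1}" and \<sigma> = "\<lambda>_. 1" and e = "\<lambda>\<kappa> _. E \<kappa>" and C = 3])
    \<comment> \<open>Lipschitz directions lie in \<open>int_dom Q\<close> through integrability, so
      there the noncanonical E is the Lebesgue--Stieltjes integral.\<close>
    fix \<kappa> L assume \<kappa>: "\<kappa> \<in> LQ_space Q" "L-lipschitz_on {0<..<1} \<kappa>"
    then have "\<kappa> \<in> int_dom Q" using LS[OF \<kappa>(2) unit] by (simp add: int_dom_def)
    then show "E \<kappa> = 1 * LS_integral Q \<kappa> {0<..<1}"
      using LS[OF \<kappa>(2) unit] by (simp add: E(3) int_dir_def)
  qed (simp_all add: unit lam_def E)
  moreover have "\<forall>K\<in>LQM_space Q M. \<forall>z\<in>ladcag_space. \<forall>\<kappa>\<in>int_dom Q. E \<kappa> + lam z K = int_dir Q \<kappa> + lam z K"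
    by (simp add: E(3))
  moreover have "unif_hadamard_derivative ({0<..<1} \<times> {0<..<1}) Q M lam_tilde (lam_tilde_deriv Q)"
  \<comment> \<open>For t < s the sign -1 records the orientation, so that the domain is always a
    half-open interval from \<open>sub_intervals\<close>.\<close>
  proof (rule unif_hadamard_derivativeI[OF assms(1),
        where B = "\<lambda>(s, t). if s \<le> t then {s<..t} else {t<..s}" and \<sigma> = "\<lambda>(s, t). if s \<le> t then 1 else -1"
          and e = "\<lambda>\<kappa> (s, t). if s \<le> t then int_dir_Ioc Q \<kappa> s t else - int_dir_Ioc Q \<kappa> t s" and C = 3])
    have "(1/2, 1/2) \<in> {0<..<1::real} \<times> {0<..<1::real}" by simp
    then show "{0<..<1::real} \<times> {0<..<1::real} \<noteq> {}" by blast
    fix i :: "real \<times> real" assume i: "i \<in> {0<..<1} \<times> {0<..<1}"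
    obtain s t where st: "i = (s, t)" "0 < s" "s < 1" "0 < t" "t < 1" using i by auto
    have sub: "{s<..t} \<in> sub_intervals" if "0 < s" "s \<le> t" "t < 1" for s t
      unfolding sub_intervals_def using that by (intro insertI2 image_eqI[of _ _ "(s, t)"]) auto
    show "(case i of (s, t) \<Rightarrow> if s \<le> t then {s<..t} else {t<..s}) \<in> sub_intervals"
      using st sub by auto
    show "\<bar>case i of (s, t) \<Rightarrow> if s \<le> t then 1 else (- 1 :: real)\<bar> \<le> 1"
      using st by auto
    show "lam_tilde q K i = (case i of (s, t) \<Rightarrow> if s \<le> t then 1 else - 1) *
        LS_integral q K (case i of (s, t) \<Rightarrow> if s \<le> t then {s<..t} else {t<..s})" for q K
      using st by (simp add: lam_tilde_def)
    show "lam_tilde_deriv Q K z \<kappa> i =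
        (case i of (s, t) \<Rightarrow> if s \<le> t then int_dir_Ioc Q \<kappa> s t else - int_dir_Ioc Q \<kappa> t s) + lam_tilde z K i" for K z \<kappa>
      using st by (simp add: lam_tilde_deriv_def)
    show "(case i of (s, t) \<Rightarrow> if s \<le> t then int_dir_Ioc Q (\<lambda>u. a * \<kappa> u + b * \<eta> u) s t
          else - int_dir_Ioc Q (\<lambda>u. a * \<kappa> u + b * \<eta> u) t s) =
        a * (case i of (s, t) \<Rightarrow> if s \<le> t then int_dir_Ioc Q \<kappa> s t else - int_dir_Ioc Q \<kappa> t s) +
        b * (case i of (s, t) \<Rightarrow> if s \<le> t then int_dir_Ioc Q \<eta> s t else - int_dir_Ioc Q \<eta> t s)"
      if "\<kappa> \<in> LQ_space Q" "\<eta> \<in> LQ_space Q" for \<kappa> \<eta> a b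
      using st that by (auto simp: int_dir_Ioc_linear[OF Q])
    show "\<bar>case i of (s, t) \<Rightarrow> if s \<le> t then int_dir_Ioc Q \<kappa> s t else - int_dir_Ioc Q \<kappa> t s\<bar> \<le> 3 * LQ_norm Q \<kappa>"
      if "\<kappa> \<in> LQ_space Q" for \<kappa>
      using st that by (auto intro!: int_dir_Ioc_bound[OF Q])
    show "(case i of (s, t) \<Rightarrow> if s \<le> t then int_dir_Ioc Q \<kappa> s t else - int_dir_Ioc Q \<kappa> t s) =
        (case i of (s, t) \<Rightarrow> if s \<le> t then 1 else - 1) *
        LS_integral Q \<kappa> (case i of (s, t) \<Rightarrow> if s \<le> t then {s<..t} else {t<..s})"
      if "\<kappa> \<in> LQ_space Q" "L-lipschitz_on {0<..<1} \<kappa>" for L \<kappa>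
      using st LS[OF that(2) sub] by (simp add: int_dir_Ioc_def)
  qed
  moreover have "\<forall>F zt \<kappa>t z \<kappa>. \<forall>K\<in>LQM_space Q M.
      hadamard_path Q F zt \<kappa>t z \<kappa> \<and> hadamard_admissible Q M F \<kappa>t K \<longrightarrow> \<kappa> \<in> int_dom Q"
    using hadamard_direction_in_int_dom[OF assms] by blast
  ultimately show ?thesis
    by (intro conjI exI[of _ "\<lambda>K z \<kappa>. E \<kappa> + lam z K"])
qed

end
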